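(* Let $H,T,(t_k),(\phi_k),p,d,B,L,\beta$ and the numbers $T_k$, intervals $F_k$ and rectangles $\Pi_k$ ($k\ge 1$) be as in the context; in particular $t_{k+p}-t_k>d$ for all $k\ge1$. Suppose $$\limsup_{k\to\infty}\beta_k<\Big(\frac{d}{2p}\Big)^2\frac{1}{8p(1+\pi^2/3)} .$$ Let $M\ge 1$, $N\ge 0$ be integers such that $$\beta_k\le \Big(\frac{d}{2p}\Big)^2\frac{1}{8p(1+\pi^2/3)}\quad\text{for all }k\ge M,\qquad \|\beta\|_\infty\le \frac{d^2}{16p^2}\Big(2p\sum_{j=N+1}^\infty \frac1{j^2}\Big)^{-1},$$ and put $K=M+N$. Let $h>0$ satisfy $\displaystyle\sum_{j=0}^\infty\frac{1}{h^2+(jd/2p)^2}\le\frac{1}{8p\|\beta\|_\infty}$ and let $$\Pi_0=\Big\{a+ib:\ -h\le a\le T_{K+1}+\frac{d}{2p},\ |b|\le h\Big\}.$$ Then the spectrum $\mathrm{Sp}\,L$ is discrete and $$\mathrm{Sp}\,L\subset \Pi_0\cup\bigcup_{j=K+1}^\infty \Pi_j .$$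
   Context: $H$ is a separable Hilbert space. $T$ is a selfadjoint operator in $H$ with discrete spectrum $\tau=\{t_k\}_{k=1}^\infty$, $T\phi_k=t_k\phi_k$, where $(\phi_k)_{k\ge1}$ is an orthonormal basis of $H$, $t_{k+1}-t_k>0$ for all $k\ge1$, and for some fixed integer $p\ge1$ and $d>0$ one has $t_{k+p}-t_k>d$ for all $k\ge1$. Blocks: put $\triangle t_k=t_{k+1}-t_k$. For each $k\ge 1$ let $\gamma(k)\in\{0,1,\dots,p-1\}$ be the integer with $\triangle t_{k+\gamma(k)}\ge d/p$ and $\triangle t_{k+j}<d/p$ for all $0\le j<\gamma(k)$ (it exists because $\triangle t_k+\dots+\triangle t_{k+p-1}>d$). Define $j_1=1$, $j_2=1+\gamma(1)$, $j_k=j_{k-1}+1+\gamma(j_{k-1}+1)$ for $k\ge 3$, and $T_k=t_{j_k}$. Let $F_1=[T_1-\frac{d}{2p},T_2+\frac{d}{2p}]$ and $F_k=[T_k+\frac{d}{2p},T_{k+1}+\frac{d}{2p}]$ for $k>1$; then $\tau\subset\bigcup_k F_k$ and each $F_k$ contains at most $p$ points of $\tau$. Let $\Pi_k=\{a+ib: a\in F_k,\ |b|\le \frac{d}{2p}\}$ for $k\ge1$. Perturbation: $B$ is a closed operator in $H$ with $\mathrm{dom}\,B\supseteq\mathrm{dom}\,T$, and $L=T+B$ with domain $\mathrm{dom}\,T$. Put $\beta_k=\|B\phi_k\|^2$, $\beta=(\beta_k)_{k\ge 1}$, $\|\beta\|_\infty=\sup_k\beta_k$; if $\|\beta\|_\infty=0$,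 then $1/(8p\|\beta\|_\infty)$ is read as $+\infty$. "Discrete spectrum" means that the spectrum consists of isolated eigenvalues of finite algebraic multiplicity.
   Formalization: The formal statement additionally assumes t_1 ≥ 0; without it the claim fails, e.g. B=0, p=1, d=1/2, t_k=k-11, M=1, N=0, h=1, where Π_0 is empty and the eigenvalue -10 is not covered. *)

theory Defs
  imports "HOL-Analysis.Analysis"
begin

section \<open>Complex Hilbert spaces\<close>

text \<open>
  The inner product is linear in its first argument. The norm, metric and topology are those of
  \<^class>\<open>real_normed_vector\<close>, tied to the inner product by \<open>norm_eq_sqrt_cinner\<close>.
\<close>

class complex_inner = real_normed_vector +
  fixes scaleC :: "complex \<Rightarrow> 'a \<Rightarrow> 'a" (infixr "*\<^sub>C" 75)
    and cinner :: "'a \<Rightarrow> 'a \<Rightarrow> complex"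
  assumes scaleC_add_right: "c *\<^sub>C (x + y) = c *\<^sub>C x + c *\<^sub>C y"
    and scaleC_add_left: "(b + c) *\<^sub>C x = b *\<^sub>C x + c *\<^sub>C x"
    and scaleC_scaleC: "b *\<^sub>C c *\<^sub>C x = (b * c) *\<^sub>C x"
    and scaleC_one: "1 *\<^sub>C x = x"
    and scaleR_scaleC: "r *\<^sub>R x = complex_of_real r *\<^sub>C x"
    and cinner_commute: "cinner x y = cnj (cinner y x)"
    and cinner_add_left: "cinner (x + y) z = cinner x z + cinner y z"
    and cinner_scaleC_left: "cinner (c *\<^sub>C x) y = c * cinner x y"
    and cinner_ge_zero: "0 \<le> Re (cinner x x)"
    and norm_eq_sqrt_cinner: "norm x = sqrt (Re (cinner x x))"

class complex_hilbert = complex_inner + complete_space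
begin

subclass banach ..

end

global_interpretation complex_vec:
  vector_space "scaleC :: complex \<Rightarrow> 'a \<Rightarrow> 'a::complex_inner"
  by unfold_locales
    (simp_all add: scaleC_add_right scaleC_add_left scaleC_scaleC scaleC_one)

definition orthonormal_basis_on :: "nat set \<Rightarrow> (nat \<Rightarrow> 'a::complex_inner) \<Rightarrow> bool" where
  "orthonormal_basis_on I \<phi> \<longleftrightarrow>
     (\<forall>i\<in>I. \<forall>j\<in>I. cinner (\<phi> i) (\<phi> j) = (if i = j then 1 else 0)) \<and>
     closure (complex_vec.span (\<phi> ` I)) = UNIV"

section \<open>Unbounded operators\<close>

text \<open>
  An operator is given by its domain \<open>D\<close> and a function \<open>A\<close>; the values of \<open>A\<close> outside \<open>D\<close> are
  never used.
\<close>

definition linear_operator :: "'a::complex_inner set \<Rightarrow> ('a \<Rightarrow> 'a) \<Rightarrow> bool" where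
  "linear_operator D A \<longleftrightarrow>
     complex_vec.subspace D \<and>
     (\<forall>x\<in>D. \<forall>y\<in>D. A (x + y) = A x + A y) \<and>
     (\<forall>c. \<forall>x\<in>D. A (c *\<^sub>C x) = c *\<^sub>C A x)"

definition op_graph :: "'a set \<Rightarrow> ('a \<Rightarrow> 'a) \<Rightarrow> ('a \<times> 'a) set" where
  "op_graph D A = {(x, A x) |x. x \<in> D}"

definition closed_operator :: "'a::complex_inner set \<Rightarrow> ('a \<Rightarrow> 'a) \<Rightarrow> bool" where
  "closed_operator D A \<longleftrightarrow> linear_operator D A \<and> closed (op_graph D A)"

definition adjoint_graph :: "'a::complex_inner set \<Rightarrow> ('a \<Rightarrow> 'a) \<Rightarrow> ('a \<times> 'a) set" where
  "adjoint_graph D A = {(y, z). \<forall>x\<in>D. cinner (A x) y = cinner x z}"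

definition selfadjoint_operator :: "'a::complex_inner set \<Rightarrow> ('a \<Rightarrow> 'a) \<Rightarrow> bool" where
  "selfadjoint_operator D A \<longleftrightarrow>
     linear_operator D A \<and> closure D = UNIV \<and> adjoint_graph D A = op_graph D A"

text \<open>The bounded inverse \<open>R\<close> of \<open>A - z\<close> is automatically complex linear.\<close>

definition resolvent_set :: "'a::complex_inner set \<Rightarrow> ('a \<Rightarrow> 'a) \<Rightarrow> complex set" where
  "resolvent_set D A =
     {z. \<exists>R. bounded_linear R \<and>
           (\<forall>y. R y \<in> D \<and> A (R y) - z *\<^sub>C R y = y) \<and>
           (\<forall>x\<in>D. R (A x - z *\<^sub>C x) = x)}"

definition spectrum :: "'a::complex_inner set \<Rightarrow> ('a \<Rightarrow> 'a) \<Rightarrow> complex set" where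
  "spectrum D A = - resolvent_set D A"

definition eigenvalue :: "'a::complex_inner set \<Rightarrow> ('a \<Rightarrow> 'a) \<Rightarrow> complex \<Rightarrow> bool" where
  "eigenvalue D A z \<longleftrightarrow> (\<exists>x\<in>D. x \<noteq> 0 \<and> A x = z *\<^sub>C x)"

text \<open>
  \<open>ker_power D A z n\<close> is the kernel of the \<open>n\<close>-th power of \<open>A - z\<close> on its natural domain. The
  algebraic multiplicity of \<open>z\<close> is the dimension of the root subspace.
\<close>

primrec ker_power ::
    "'a::complex_inner set \<Rightarrow> ('a \<Rightarrow> 'a) \<Rightarrow> complex \<Rightarrow> nat \<Rightarrow> 'a set" where
  "ker_power D A z 0 = {0}"
| "ker_power D A z (Suc n) = {x \<in> D. A x - z *\<^sub>C x \<in> ker_power D A z n}"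

definition root_subspace ::
    "'a::complex_inner set \<Rightarrow> ('a \<Rightarrow> 'a) \<Rightarrow> complex \<Rightarrow> 'a set" where
  "root_subspace D A z = (\<Union>n. ker_power D A z n)"

definition finite_alg_mult ::
    "'a::complex_inner set \<Rightarrow> ('a \<Rightarrow> 'a) \<Rightarrow> complex \<Rightarrow> bool" where
  "finite_alg_mult D A z \<longleftrightarrow>
     (\<exists>S. finite S \<and> root_subspace D A z \<subseteq> complex_vec.span S)"

definition discrete_spectrum :: "'a::complex_inner set \<Rightarrow> ('a \<Rightarrow> 'a) \<Rightarrow> bool" where
  "discrete_spectrum D A \<longleftrightarrow>
     (\<forall>z \<in> spectrum D A.
        z isolated_in spectrum D A \<and> eigenvalue D A z \<and> finite_alg_mult D A z)"

section \<open>Blocks of eigenvalues, intervals and rectangles\<close>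

text \<open>
  All sequences are indexed from 1; values at index 0 are irrelevant. The description in
  \<open>block_gap\<close> is satisfied by exactly one \<open>g\<close> when \<open>t (k + p) - t k > d\<close>.
\<close>

definition block_gap :: "(nat \<Rightarrow> real) \<Rightarrow> nat \<Rightarrow> real \<Rightarrow> nat \<Rightarrow> nat" where
  "block_gap t p d k =
     (THE g. g < p \<and> t (k + g + 1) - t (k + g) \<ge> d / real p \<and>
             (\<forall>j<g. t (k + j + 1) - t (k + j) < d / real p))"

fun block_index :: "(nat \<Rightarrow> real) \<Rightarrow> nat \<Rightarrow> real \<Rightarrow> nat \<Rightarrow> nat" where
  "block_index t p d 0 = 0"
| "block_index t p d (Suc 0) = 1"
| "block_index t p d (Suc (Suc 0)) = 1 + block_gap t p d 1"
| "block_index t p d (Suc (Suc (Suc k))) =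
     block_index t p d (Suc (Suc k)) + 1 + block_gap t p d (block_index t p d (Suc (Suc k)) + 1)"

definition block_point :: "(nat \<Rightarrow> real) \<Rightarrow> nat \<Rightarrow> real \<Rightarrow> nat \<Rightarrow> real" where
  "block_point t p d k = t (block_index t p d k)"

definition block_interval :: "(nat \<Rightarrow> real) \<Rightarrow> nat \<Rightarrow> real \<Rightarrow> nat \<Rightarrow> real set" where
  "block_interval t p d k =
     (if k = 1
      then {block_point t p d 1 - d / (2 * real p) .. block_point t p d 2 + d / (2 * real p)}
      else {block_point t p d k + d / (2 * real p) .. block_point t p d (k + 1) + d / (2 * real p)})"

definition block_rect :: "(nat \<Rightarrow> real) \<Rightarrow> nat \<Rightarrow> real \<Rightarrow> nat \<Rightarrow> complex set" where
  "block_rect t p d k =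
     {z. Re z \<in> block_interval t p d k \<and> \<bar>Im z\<bar> \<le> d / (2 * real p)}"

text \<open>
  The left edge does not depend on \<open>t 1\<close>, so this rectangle can only enclose the lower part of
  the spectrum when \<open>t\<close> is bounded below appropriately, for instance by 0.
\<close>

definition initial_rect ::
    "(nat \<Rightarrow> real) \<Rightarrow> nat \<Rightarrow> real \<Rightarrow> nat \<Rightarrow> real \<Rightarrow> complex set" where
  "initial_rect t p d K h =
     {z. - h \<le> Re z \<and> Re z \<le> block_point t p d (K + 1) + d / (2 * real p) \<and> \<bar>Im z\<bar> \<le> h}"

section \<open>Size of the perturbation along the basis\<close>

definition pert_seq :: "('a::real_normed_vector \<Rightarrow> 'a) \<Rightarrow> (nat \<Rightarrow> 'a) \<Rightarrow> nat \<Rightarrow> real" where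
  "pert_seq B \<phi> k = (norm (B (\<phi> k)))\<^sup>2"

text \<open>
  Only meaningful when the sequence is bounded, which a finite upper limit guarantees.
\<close>

definition pert_sup :: "('a::real_normed_vector \<Rightarrow> 'a) \<Rightarrow> (nat \<Rightarrow> 'a) \<Rightarrow> real" where
  "pert_sup B \<phi> = (SUP k\<in>{1..}. pert_seq B \<phi> k)"

end

theory Submission
  imports Defs
begin

text \<open>
  Let \<open>z\<close> be a point outside the spectrum of \<open>T\<close>. Then \<open>L - z = (1 + B Q) (T - z)\<close> with
  \<open>Q = (T - z)\<^sup>-\<^sup>1\<close>, and by Cauchy-Schwarz \<open>\<parallel>B Q\<parallel>\<^sup>2 \<le> \<Sum> \<beta> k / |t k - z|\<^sup>2\<close>. So \<open>z\<close> is in the resolvent set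
  of \<open>L\<close> as soon as this sum is smaller than 1 (\<open>perturbed_diagonal_invertible\<close>). Since \<open>t (k +
  p) - t k > d\<close>, the points on either side of \<open>Re z\<close> fall into groups of \<open>p\<close>, the \<open>i\<close>-th group at
  distance at least \<open>i d\<close>, and the sum is bounded by explicit series. To the left of \<open>-h\<close>, where
  all \<open>t k \<ge> 0\<close> are on one side of \<open>Re z\<close>, and above and below the rectangle \<open>\<Pi> 0\<close>, the bound on
  \<open>h\<close> makes it at most \<open>1/4\<close>. To the right of \<open>T (K + 1) + d/2p\<close>, at height more than \<open>d/2p\<close>, the
  indices \<open>k \<ge> M\<close> contribute at most \<open>1/4\<close> because their \<open>\<beta> k\<close> are small. The indices \<open>k < M\<close>
  contribute at most \<open>1/32\<close> because \<open>N + 1\<close> gaps between blocks, each of length at least \<open>d/p\<close>,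
  separate \<open>t k\<close> from \<open>Re z\<close> (\<open>block_point_growth\<close>). What remains of the plane is the region of
  the theorem.

  For discreteness, fix any \<open>z\<close>. Moving finitely many eigenvalues of \<open>T\<close> far away, that is,
  adding a finite-rank operator \<open>F\<close>, makes the sum above small, so that \<open>L + F - z\<close> has an
  inverse of arbitrarily small norm (\<open>perturbed_diagonal_resolvent_far\<close>). A Fredholm argument in
  the range of \<open>F\<close> then shows that every spectral point is an eigenvalue
  (\<open>finite_rank_alternative\<close>). For the rest, consider orthonormal systems in which \<open>L\<close> acts by a
  triangular matrix with diagonal entries in a fixed disc around a point \<open>z0\<close> of the resolvent
  set. The resolvent \<open>R\<close> at \<open>z0\<close> is triangular in the same system, so that \<open>|\<langle>R x, x\<rangle>|\<close> is
  bounded below on its members; but \<open>R\<close> is a small operator plus one of finite rank, and Bessel's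
  inequality bounds the length of the system (\<open>triangular_length_bound\<close>). Infinitely many
  eigenvalues in a disc, or an infinite-dimensional root subspace, would by Gram-Schmidt give
  arbitrarily long systems. Apart from the Fredholm argument this replaces the spectral theory of
  compact operators.
\<close>

section \<open>Complex inner products\<close>

lemma cinner_add_right: "cinner x (y + z) = cinner x y + cinner x z"
  by (metis cinner_add_left cinner_commute complex_cnj_add)

lemma cinner_scaleC_right: "cinner x (c *\<^sub>C y) = cnj c * cinner x y"
  by (metis cinner_commute cinner_scaleC_left complex_cnj_mult)

lemma cinner_self: "cinner x x = of_real ((norm x)\<^sup>2)"
proof -
  have "Im (cinner x x) = 0"
    by (metis cinner_commute complex_cnj_cancel_iff complex_is_Real_iff Reals_cnj_iff)
  moreover have "Re (cinner x x) = (norm x)\<^sup>2"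
    by (simp add: norm_eq_sqrt_cinner cinner_ge_zero)
  ultimately show ?thesis by (simp add: complex_eq_iff)
qed

lemma norm_scaleC: "norm (c *\<^sub>C x) = cmod c * norm (x :: 'a::complex_inner)"
proof -
  have "of_real ((norm (c *\<^sub>C x))\<^sup>2) = (c * cnj c) * cinner x x"
    by (simp only: cinner_self[symmetric] cinner_scaleC_left cinner_scaleC_right mult_ac)
  also have "\<dots> = of_real ((cmod c * norm x)\<^sup>2)"
    by (simp add: cinner_self complex_norm_square[symmetric] power_mult_distrib)
  finally have "(norm (c *\<^sub>C x))\<^sup>2 = (cmod c * norm x)\<^sup>2"
    by (simp only: of_real_eq_iff)
  then show ?thesis by (simp add: power2_eq_iff_nonneg)
qed

lemma cinner_diff_left: "cinner (x - y) z = cinner x z - cinner y z"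
  by (metis add_diff_cancel cinner_add_left diff_add_cancel)

text \<open>Cauchy-Schwarz: the square of the norm of \<open>\<parallel>y\<parallel>\<^sup>2 x - \<langle>x, y\<rangle> y\<close> is nonnegative.\<close>

lemma Cauchy_Schwarz_cinner: "cmod (cinner x y) \<le> norm x * norm y"
proof (cases "y = 0")
  case True
  have "cinner x 0 = cinner x 0 + cinner x 0" by (metis add_0 cinner_add_right)
  with True show ?thesis by simp
next
  case False
  define c where "c = cinner x y / of_real ((norm y)\<^sup>2)"
  have "cinner (x - c *\<^sub>C y) y = 0"
    using False by (simp add: cinner_diff_left cinner_scaleC_left c_def cinner_self)
  then have orth: "cinner (x - c *\<^sub>C y) (c *\<^sub>C y) = 0"
    by (simp add: cinner_scaleC_right)
  then have orth': "cinner (c *\<^sub>C y) (x - c *\<^sub>C y) = 0"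
    by (metis cinner_commute complex_cnj_zero)
  have "cinner x x = cinner ((x - c *\<^sub>C y) + c *\<^sub>C y) ((x - c *\<^sub>C y) + c *\<^sub>C y)" by simp
  also have "\<dots> = cinner (x - c *\<^sub>C y) (x - c *\<^sub>C y) + cinner (c *\<^sub>C y) (c *\<^sub>C y)"
    using orth orth' by (simp only: cinner_add_left cinner_add_right) simp
  finally have "(norm x)\<^sup>2 = (norm (x - c *\<^sub>C y))\<^sup>2 + (norm (c *\<^sub>C y))\<^sup>2"
    unfolding cinner_self by (metis of_real_add of_real_eq_iff)
  then have "(norm (c *\<^sub>C y))\<^sup>2 \<le> (norm x)\<^sup>2" by simp
  then have "cmod c * norm y \<le> norm x" by (simp add: norm_scaleC)
  moreover have "cmod c * norm y = cmod (cinner x y) / norm y"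
    using False by (simp add: c_def norm_divide power2_eq_square norm_mult)
  ultimately show ?thesis using False by (simp add: divide_le_eq)
qed

global_interpretation cinner: bounded_bilinear "cinner :: 'a::complex_inner \<Rightarrow> 'a \<Rightarrow> complex"
proof
  show "\<exists>K. \<forall>a b. norm (cinner (a :: 'a) b) \<le> norm a * norm b * K"
    by (intro exI[of _ 1]) (simp add: Cauchy_Schwarz_cinner)
qed (simp_all add: cinner_add_left cinner_add_right scaleR_scaleC cinner_scaleC_left
      cinner_scaleC_right scaleR_conv_of_real)

global_interpretation scaleC:
  bounded_bilinear "scaleC :: complex \<Rightarrow> 'a \<Rightarrow> 'a::complex_inner"
proof
  show "\<exists>K. \<forall>a b. norm (a *\<^sub>C (b :: 'a)) \<le> norm a * norm b * K"
    by (intro exI[of _ 1]) (simp add: norm_scaleC)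
qed (simp_all add: scaleC_add_left scaleC_add_right scaleR_scaleC scaleC_scaleC
      scaleR_conv_of_real mult.commute)

lemma cinner_span_eq_0:
  assumes "\<And>x. x \<in> S \<Longrightarrow> cinner y x = 0" and "w \<in> complex_vec.span S"
  shows "cinner y w = 0"
  using assms(2)
  by (induction rule: complex_vec.span_induct_alt)
     (simp_all add: cinner.zero_right cinner_add_right cinner_scaleC_right assms(1))

text \<open>Pythagoras for a finite orthonormal family.\<close>

lemma norm_sum_orthonormal:
  assumes "finite I" and "\<And>i j. i \<in> I \<Longrightarrow> j \<in> I \<Longrightarrow> cinner (e i) (e j) = (if i = j then 1 else 0)"
  shows "(norm (\<Sum>i\<in>I. c i *\<^sub>C e i))\<^sup>2 = (\<Sum>i\<in>I. (cmod (c i))\<^sup>2)"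
proof -
  have "complex_of_real ((norm (\<Sum>i\<in>I. c i *\<^sub>C e i))\<^sup>2)
      = (\<Sum>i\<in>I. \<Sum>j\<in>I. c i * (cnj (c j) * cinner (e i) (e j)))"
    unfolding cinner_self[symmetric]
    by (subst cinner.sum_left)
       (simp add: cinner.sum_right cinner_scaleC_left cinner_scaleC_right sum_distrib_left mult_ac)
  also have "\<dots> = (\<Sum>i\<in>I. \<Sum>j\<in>I. if i = j then c i * cnj (c i) else 0)"
    by (intro sum.cong refl) (auto simp: assms(2))
  also have "\<dots> = of_real (\<Sum>i\<in>I. (cmod (c i))\<^sup>2)"
    using assms(1) by (simp add: complex_norm_square[symmetric])
  finally show ?thesis by (simp only: of_real_eq_iff)
qed

text \<open>
  Bessel's inequality for a bounded functional instead of an inner product. Testing \<open>f\<close> on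
  \<open>\<Sum> cnj (f (e i)) e i\<close> gives it without representing \<open>f\<close> by a vector.
\<close>

lemma Bessel_functional:
  assumes I: "finite I"
    and on: "\<And>i j. i \<in> I \<Longrightarrow> j \<in> I \<Longrightarrow> cinner (e i) (e j) = (if i = j then 1 else 0)"
    and add: "\<And>x y. f (x + y) = f x + f y" and scale: "\<And>c x. f (c *\<^sub>C x) = c * f x"
    and bound: "\<And>x. cmod (f x) \<le> K * norm x"
  shows "(\<Sum>i\<in>I. (cmod (f (e i)))\<^sup>2) \<le> K\<^sup>2"
proof -
  define s where "s = (\<Sum>i\<in>I. (cmod (f (e i)))\<^sup>2)"
  define x where "x = (\<Sum>i\<in>I. cnj (f (e i)) *\<^sub>C e i)"
  have s0: "s \<ge> 0" unfolding s_def by (intro sum_nonneg) auto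
  have f0: "f 0 = 0" using add[of 0 0] by simp
  have "f x = (\<Sum>i\<in>I. f (cnj (f (e i)) *\<^sub>C e i))"
    unfolding x_def using I by (induction I) (simp_all add: f0 add)
  also have "\<dots> = of_real s"
    by (simp add: scale s_def complex_norm_square[symmetric] mult.commute)
  finally have "cmod (f x) = s" using s0 by simp
  moreover have "norm x = sqrt s"
    using norm_sum_orthonormal[OF I on, of "\<lambda>i. cnj (f (e i))"]
    by (simp add: x_def s_def real_sqrt_unique)
  ultimately have "s \<le> K * sqrt s" using bound[of x] by simp
  then have "s\<^sup>2 \<le> (K * sqrt s)\<^sup>2" using s0 by (intro power_mono) auto
  then have "s * s \<le> K\<^sup>2 * s" using s0 by (simp add: power_mult_distrib power2_eq_square[of s])
  then show ?thesis using s0 unfolding s_def[symmetric]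
    by (cases "s = 0") (auto simp: mult_le_cancel_right)
qed

section \<open>Expansion in an orthonormal basis\<close>

locale hilbert_basis =
  fixes e :: "nat \<Rightarrow> 'a::complex_hilbert"
  assumes orthonormal: "cinner (e i) (e j) = (if i = j then 1 else 0)"
    and total: "closure (complex_vec.span (range e)) = UNIV"
begin

lemma norm_e [simp]: "norm (e i) = 1"
  using orthonormal[of i i] by (simp add: norm_eq_sqrt_cinner)

lemma eqI_coeffs:
  assumes "\<And>k. cinner x (e k) = cinner y (e k)"
  shows "x = y"
proof -
  define u where "u = x - y"
  have "closed {w. cinner u w = 0}"
    by (intro closed_Collect_eq cinner.continuous_on continuous_on_const continuous_on_id)
  moreover have "complex_vec.span (range e) \<subseteq> {w. cinner u w = 0}"
    using assms cinner_span_eq_0[of "range e" u]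
    by (fastforce simp: u_def cinner_diff_left)
  ultimately have "closure (complex_vec.span (range e)) \<subseteq> {w. cinner u w = 0}"
    by (rule closure_minimal[rotated])
  then have "cinner u u = 0" using total by auto
  then show ?thesis by (simp add: cinner_self u_def)
qed

lemma Bessel: "(\<Sum>k<n. (cmod (cinner x (e k)))\<^sup>2) \<le> (norm x)\<^sup>2"
  using Bessel_functional[of "{..<n}" e "\<lambda>y. cnj (cinner x y)" "norm x"] Cauchy_Schwarz_cinner[of x]
  by (simp add: orthonormal cinner_add_right cinner_scaleC_right)

lemma summable_expansion:
  assumes "summable (\<lambda>k. (cmod (a k))\<^sup>2)"
  shows "summable (\<lambda>k. a k *\<^sub>C e k)"
  unfolding summable_Cauchy
proof (intro allI impI)
  fix r :: real assume "r > 0"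
  then obtain N where N: "\<And>m n. m \<ge> N \<Longrightarrow> norm (\<Sum>k = m..<n. (cmod (a k))\<^sup>2) < r\<^sup>2"
    using assms unfolding summable_Cauchy by (meson zero_less_power)
  have "norm (\<Sum>k = m..<n. a k *\<^sub>C e k) < r" if "m \<ge> N" for m n
  proof -
    have "(norm (\<Sum>k = m..<n. a k *\<^sub>C e k))\<^sup>2 = (\<Sum>k = m..<n. (cmod (a k))\<^sup>2)"
      by (rule norm_sum_orthonormal) (auto simp: orthonormal)
    also have "\<dots> < r\<^sup>2" using N[OF that, of n] by (simp add: sum_nonneg)
    finally show ?thesis using \<open>r > 0\<close> by (simp add: power_less_imp_less_base)
  qed
  then show "\<exists>N. \<forall>m\<ge>N. \<forall>n. norm (\<Sum>k = m..<n. a k *\<^sub>C e k) < r" by blast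
qed

lemma coeff_expansion:
  assumes "summable (\<lambda>k. a k *\<^sub>C e k)"
  shows "cinner (\<Sum>k. a k *\<^sub>C e k) (e j) = a j"
proof -
  have "(\<lambda>k. cinner (a k *\<^sub>C e k) (e j)) sums cinner (\<Sum>k. a k *\<^sub>C e k) (e j)"
    by (rule bounded_linear.sums[OF cinner.bounded_linear_left summable_sums[OF assms]])
  moreover have "(\<lambda>k. cinner (a k *\<^sub>C e k) (e j)) = (\<lambda>k. if k = j then a j else 0)"
    by (auto simp: cinner_scaleC_left orthonormal)
  ultimately show ?thesis
    using sums_single[of j "\<lambda>_. a j"] by (metis (no_types, lifting) ext sums_unique2)
qed

lemma summable_coeffs: "summable (\<lambda>k. (cmod (cinner x (e k)))\<^sup>2)"
  by (rule summableI_nonneg_bounded[where x = "(norm x)\<^sup>2"]) (auto intro: Bessel)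

lemma expansion: "(\<lambda>k. cinner x (e k) *\<^sub>C e k) sums x"
proof -
  have s: "summable (\<lambda>k. cinner x (e k) *\<^sub>C e k)"
    by (rule summable_expansion[OF summable_coeffs])
  have "(\<Sum>k. cinner x (e k) *\<^sub>C e k) = x"
    by (rule eqI_coeffs) (rule coeff_expansion[OF s])
  then show ?thesis using s by (metis summable_sums)
qed

lemma Parseval: "(\<lambda>k. cinner x (e k) * cnj (cinner y (e k))) sums cinner x y"
proof -
  have "(\<lambda>k. cinner (cinner x (e k) *\<^sub>C e k) y) sums cinner x y"
    by (rule bounded_linear.sums[OF cinner.bounded_linear_left expansion])
  then show ?thesis
    by (simp add: cinner_scaleC_left cinner_commute[of "e _" y])
qed

lemma Parseval_norm: "(\<lambda>k. (cmod (cinner x (e k)))\<^sup>2) sums (norm x)\<^sup>2"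
  using Parseval[of x x]
  by (simp only: cinner_self complex_norm_square[symmetric] sums_of_real_iff)

end

section \<open>Linear operators and resolvents\<close>

lemma linear_operatorD:
  assumes "linear_operator D A"
  shows "complex_vec.subspace D"
    and "x \<in> D \<Longrightarrow> y \<in> D \<Longrightarrow> A (x + y) = A x + A y"
    and "x \<in> D \<Longrightarrow> A (c *\<^sub>C x) = c *\<^sub>C A x"
    and "A 0 = 0"
    and "x \<in> D \<Longrightarrow> y \<in> D \<Longrightarrow> A (x - y) = A x - A y"
proof -
  have D: "complex_vec.subspace D" and scale: "\<And>c x. x \<in> D \<Longrightarrow> A (c *\<^sub>C x) = c *\<^sub>C A x"
    and add: "\<And>x y. x \<in> D \<Longrightarrow> y \<in> D \<Longrightarrow> A (x + y) = A x + A y"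
    using assms by (auto simp: linear_operator_def)
  show "complex_vec.subspace D" by (fact D)
  show "A (c *\<^sub>C x) = c *\<^sub>C A x" if "x \<in> D" using that by (rule scale)
  show "A (x + y) = A x + A y" if "x \<in> D" "y \<in> D" using that by (rule add)
  show "A 0 = 0"
    using scale[of 0 0] complex_vec.subspace_0[OF D] by simp
  show "A (x - y) = A x - A y" if "x \<in> D" "y \<in> D"
    using add[of "x - y" y] that complex_vec.subspace_diff[OF D] by (simp add: algebra_simps)
qed

lemma linear_operator_sum:
  assumes A: "linear_operator D A" and I: "finite I" and x: "\<And>i. i \<in> I \<Longrightarrow> x i \<in> D"
  shows "A (\<Sum>i\<in>I. c i *\<^sub>C x i) = (\<Sum>i\<in>I. c i *\<^sub>C A (x i))"
proof -
  note D = linear_operatorD(1)[OF A]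
  have "A (\<Sum>i\<in>J. c i *\<^sub>C x i) = (\<Sum>i\<in>J. c i *\<^sub>C A (x i))" if "J \<subseteq> I" for J
    using finite_subset[OF that I] that
  proof (induction J)
    case (insert j J)
    then show ?case
      by (simp add: linear_operatorD(2,3)[OF A] x complex_vec.subspace_scale[OF D]
          complex_vec.subspace_sum[OF D] subset_iff)
  qed (simp add: linear_operatorD(4)[OF A])
  then show ?thesis by blast
qed

lemma linear_operator_add:
  assumes "linear_operator D A" "linear_operator E B" "D \<subseteq> E"
  shows "linear_operator D (\<lambda>x. A x + B x)"
  using assms by (auto simp: linear_operator_def subset_iff scaleC_add_right algebra_simps)

lemma linear_operator_bounded:
  assumes "linear_operator UNIV A" "\<And>x. norm (A x) \<le> K * norm x"
  shows "bounded_linear A"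
proof (rule bounded_linear_intro[where K = K])
  show "A (r *\<^sub>R x) = r *\<^sub>R A x" for r x
    using linear_operatorD(3)[OF assms(1), of x "of_real r"] by (simp add: scaleR_scaleC)
qed (use assms linear_operatorD(2)[OF assms(1)] in \<open>auto simp: mult.commute\<close>)

lemma resolvent_setI:
  assumes A: "linear_operator D A"
    and surj: "\<And>y. \<exists>x\<in>D. A x - z *\<^sub>C x = y"
    and bound: "\<And>x. x \<in> D \<Longrightarrow> norm x \<le> K * norm (A x - z *\<^sub>C x)"
  shows "z \<in> resolvent_set D A"
proof -
  note D = linear_operatorD(1)[OF A]
  obtain R where R: "\<And>y. R y \<in> D" "\<And>y. A (R y) - z *\<^sub>C R y = y"
    using surj by metis
  have inj: "x = y" if "x \<in> D" "y \<in> D" "A x - z *\<^sub>C x = A y - z *\<^sub>C y" for x y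
  proof -
    have "A (x - y) - z *\<^sub>C (x - y) = 0"
      using that by (simp add: linear_operatorD(5)[OF A] scaleC.diff_right algebra_simps)
    then show ?thesis
      using bound[of "x - y"] complex_vec.subspace_diff[OF D] that by simp
  qed
  have inv: "R (A x - z *\<^sub>C x) = x" if "x \<in> D" for x
    by (rule inj) (use R that in auto)
  have "linear_operator UNIV R"
    unfolding linear_operator_def
  proof (intro conjI ballI allI)
    show "R (x + y) = R x + R y" for x y
      by (rule inj) (simp_all add: R complex_vec.subspace_add[OF D] linear_operatorD(2)[OF A]
          scaleC_add_right add_diff_add)
    show "R (c *\<^sub>C x) = c *\<^sub>C R x" for c x
    proof (rule inj)
      have "A (c *\<^sub>C R x) - z *\<^sub>C c *\<^sub>C R x = c *\<^sub>C (A (R x) - z *\<^sub>C R x)"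
        by (simp add: linear_operatorD(3)[OF A R(1)] scaleC.diff_right mult.commute)
      then show "A (R (c *\<^sub>C x)) - z *\<^sub>C R (c *\<^sub>C x) = A (c *\<^sub>C R x) - z *\<^sub>C c *\<^sub>C R x"
        by (simp add: R)
    qed (simp_all add: R complex_vec.subspace_scale[OF D])
  qed simp
  moreover have "norm (R y) \<le> K * norm y" for y
    using bound[OF R(1), of y] by (simp add: R)
  ultimately have "bounded_linear R" by (rule linear_operator_bounded)
  then show ?thesis using R inv unfolding resolvent_set_def by blast
qed

lemma resolvent_setE:
  assumes A: "linear_operator D A" and z: "z \<in> resolvent_set D A"
  obtains R where "bounded_linear R" "linear_operator UNIV R" "\<And>y. R y \<in> D"
    "\<And>y. A (R y) - z *\<^sub>C R y = y" "\<And>x. x \<in> D \<Longrightarrow> R (A x - z *\<^sub>C x) = x"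
proof -
  obtain R where R: "bounded_linear R" "\<And>y. R y \<in> D" "\<And>y. A (R y) - z *\<^sub>C R y = y"
    "\<And>x. x \<in> D \<Longrightarrow> R (A x - z *\<^sub>C x) = x"
    using z unfolding resolvent_set_def by blast
  have "R (c *\<^sub>C y) = c *\<^sub>C R y" for c y
  proof -
    have "A (c *\<^sub>C R y) - z *\<^sub>C c *\<^sub>C R y = c *\<^sub>C (A (R y) - z *\<^sub>C R y)"
      by (simp add: linear_operatorD(3)[OF A R(2)] scaleC.diff_right mult.commute)
    then show ?thesis
      using R(4)[of "c *\<^sub>C R y"] complex_vec.subspace_scale[OF linear_operatorD(1)[OF A] R(2)]
      by (simp add: R(3))
  qed
  then have "linear_operator UNIV R"
    using R(1) by (simp add: linear_operator_def bounded_linear.linear linear_add)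
  with R show thesis using that by blast
qed

section \<open>Perturbations of diagonal operators\<close>

context hilbert_basis begin

text \<open>
  The equivalence gives \<open>A\<close> its maximal domain: every \<open>x\<close> for which the coefficients \<open>s k \<langle>x, e k\<rangle>\<close>
  belong to some vector.
\<close>

definition diagonal :: "(nat \<Rightarrow> complex) \<Rightarrow> 'a set \<Rightarrow> ('a \<Rightarrow> 'a) \<Rightarrow> bool" where
  "diagonal s D A \<longleftrightarrow>
     (\<forall>x y. x \<in> D \<and> A x = y \<longleftrightarrow> (\<forall>k. cinner y (e k) = s k * cinner x (e k)))"

lemma diagonalI:
  assumes "diagonal s D A" "\<And>k. cinner y (e k) = s k * cinner x (e k)"
  shows "x \<in> D" "A x = y"
  using assms unfolding diagonal_def by blast+

lemma diagonalD:
  assumes "diagonal s D A" "x \<in> D"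
  shows "cinner (A x) (e k) = s k * cinner x (e k)"
  using assms unfolding diagonal_def by blast

lemma diagonal_basis:
  assumes "diagonal s D A"
  shows "e k \<in> D"
  by (rule diagonalI(1)[OF assms, where y = "s k *\<^sub>C e k"])
     (simp add: cinner_scaleC_left orthonormal)

lemma diagonal_linear_operator:
  assumes A: "diagonal s D A"
  shows "linear_operator D A"
proof -
  have "x + y \<in> D" "A (x + y) = A x + A y" if "x \<in> D" "y \<in> D" for x y
    using diagonalI[OF A, of "A x + A y" "x + y"] that
    by (simp_all add: diagonalD[OF A] cinner_add_left algebra_simps)
  moreover have "c *\<^sub>C x \<in> D" "A (c *\<^sub>C x) = c *\<^sub>C A x" if "x \<in> D" for c x
    using diagonalI[OF A, of "c *\<^sub>C A x" "c *\<^sub>C x"] that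
    by (simp_all add: diagonalD[OF A] cinner_scaleC_left algebra_simps)
  moreover have "0 \<in> D"
    using diagonalI(1)[OF A, of 0 0] by (simp add: cinner.zero_left)
  ultimately show ?thesis
    unfolding linear_operator_def complex_vec.subspace_def by simp
qed

text \<open>
  Parseval's identity turns the coefficientwise relation \<open>y = T x\<close> into
  \<open>\<langle>T u, x\<rangle> = \<langle>u, y\<rangle>\<close> for all \<open>u\<close> in the domain, and this says that \<open>(x, y)\<close> is in the
  graph of the adjoint.
\<close>

lemma selfadjoint_diagonal:
  assumes sa: "selfadjoint_operator D T"
    and eigen: "\<And>k. e k \<in> D" "\<And>k. T (e k) = complex_of_real (t k) *\<^sub>C e k"
  shows "diagonal (\<lambda>k. complex_of_real (t k)) D T"
  unfolding diagonal_def
proof (intro allI iffI)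
  have graph: "(\<forall>u\<in>D. cinner (T u) x = cinner u y) \<longleftrightarrow> x \<in> D \<and> y = T x" for x y
    using sa unfolding selfadjoint_operator_def adjoint_graph_def op_graph_def by blast
  have coeff: "cinner (T u) (e k) = of_real (t k) * cinner u (e k)" if "u \<in> D" for u k
  proof -
    have "cinner (T (e k)) u = cinner (e k) (T u)" using graph[of u "T u"] eigen(1) that by blast
    then have "cinner (T u) (e k) = cnj (cinner (T (e k)) u)" by (metis cinner_commute)
    also have "\<dots> = of_real (t k) * cinner u (e k)"
      by (simp add: eigen(2) cinner_scaleC_left cinner_commute[of "e k" u])
    finally show ?thesis .
  qed
  {
    fix x y k assume "x \<in> D \<and> T x = y"
    then show "cinner y (e k) = of_real (t k) * cinner x (e k)" using coeff by blast
  next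
    fix x y assume xy: "\<forall>k. cinner y (e k) = of_real (t k) * cinner x (e k)"
    have "cinner (T u) x = cinner u y" if "u \<in> D" for u
    proof -
      have "(\<lambda>k. cinner (T u) (e k) * cnj (cinner x (e k)))
          = (\<lambda>k. cinner u (e k) * cnj (cinner y (e k)))"
        by (auto simp: coeff[OF that] xy)
      then show ?thesis using Parseval[of "T u" x] Parseval[of u y] by (metis sums_unique2)
    qed
    then show "x \<in> D \<and> T x = y" using graph[of x y] by simp
  }
qed

text \<open>
  The series \<open>\<Sum> a k B (e k)\<close> converges absolutely by Cauchy-Schwarz, so closedness of \<open>B\<close>
  identifies its sum with the value of \<open>B\<close> at \<open>x\<close>. This is where the numbers
  \<open>\<parallel>B (e k)\<parallel>\<^sup>2 / |s k - z|\<^sup>2\<close> enter.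
\<close>

lemma diagonal_resolvent:
  assumes A: "diagonal s D A" and B: "closed_operator E B" and DE: "D \<subseteq> E"
    and c: "c > 0" "\<And>k. c \<le> cmod (s k - z)"
    and q: "\<And>n. (\<Sum>k<n. (norm (B (e k)))\<^sup>2 / (cmod (s k - z))\<^sup>2) \<le> q"
  shows "\<exists>x\<in>D. A x - z *\<^sub>C x = w \<and> norm x \<le> norm w / c \<and> norm (B x) \<le> sqrt q * norm w"
proof -
  have B_lin: "linear_operator E B" and B_closed: "closed (op_graph E B)"
    using B unfolding closed_operator_def by auto
  define a where "a k = cinner w (e k) / (s k - z)" for k
  have nz: "s k - z \<noteq> 0" for k using c(2)[of k] c(1) by auto
  have a_le: "(cmod (a k))\<^sup>2 \<le> (cmod (cinner w (e k)))\<^sup>2 / c\<^sup>2" for k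
    unfolding a_def norm_divide power_divide
    by (intro divide_left_mono power_mono c mult_pos_pos zero_less_power) (use c nz in auto)
  have sum_a: "summable (\<lambda>k. (cmod (a k))\<^sup>2)"
    by (rule summable_comparison_test'[OF summable_divide[OF summable_coeffs[of w], of "c\<^sup>2"], of 0])
       (simp add: a_le)
  define x where "x = (\<Sum>k. a k *\<^sub>C e k)"
  have x_sum: "summable (\<lambda>k. a k *\<^sub>C e k)" by (rule summable_expansion[OF sum_a])
  have x_coeff: "cinner x (e k) = a k" for k
    unfolding x_def by (rule coeff_expansion[OF x_sum])
  have "cinner (w + z *\<^sub>C x) (e k) = s k * cinner x (e k)" for k
    using nz[of k] by (simp add: cinner_add_left cinner_scaleC_left x_coeff)
      (simp add: a_def field_simps)
  note Ax = diagonalI[OF A this]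
  have "(norm x)\<^sup>2 \<le> (norm w)\<^sup>2 / c\<^sup>2"
    by (rule sums_le[OF _ Parseval_norm sums_divide[OF Parseval_norm]])
       (use a_le in \<open>simp add: x_coeff\<close>)
  then have x_le: "norm x \<le> norm w / c"
    using c(1) by (metis power_divide power2_le_imp_le divide_nonneg_pos norm_ge_zero)
  have partial: "(\<Sum>k<n. norm (a k *\<^sub>C B (e k))) \<le> sqrt q * norm w" for n
  proof -
    have "(\<Sum>k<n. norm (a k *\<^sub>C B (e k)))
        = (\<Sum>k<n. cmod (cinner w (e k)) * (norm (B (e k)) / cmod (s k - z)))"
      by (simp add: norm_scaleC a_def norm_divide)
    also have "\<dots>\<^sup>2 \<le> (\<Sum>k<n. (cmod (cinner w (e k)))\<^sup>2)
        * (\<Sum>k<n. (norm (B (e k)) / cmod (s k - z))\<^sup>2)"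
      by (rule Cauchy_Schwarz_ineq_sum)
    also have "\<dots> \<le> (norm w)\<^sup>2 * q"
      using q[of n] by (intro mult_mono Bessel) (auto simp: power_divide intro: sum_nonneg)
    finally show ?thesis
      by (auto dest!: real_le_rsqrt simp: real_sqrt_mult mult.commute)
  qed
  have abs_sum: "summable (\<lambda>k. norm (a k *\<^sub>C B (e k)))"
    by (rule summableI_nonneg_bounded[where x = "sqrt q * norm w"]) (auto intro: partial)
  define Y where "Y = (\<Sum>k. a k *\<^sub>C B (e k))"
  have eE: "e k \<in> E" for k using diagonal_basis[OF A] DE by blast
  have "(x, Y) \<in> op_graph E B"
  proof (rule closed_sequentially[OF B_closed])
    fix n
    have "(\<Sum>k<n. a k *\<^sub>C e k) \<in> E"
      by (intro complex_vec.subspace_sum[OF linear_operatorD(1)[OF B_lin]]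
          complex_vec.subspace_scale[OF linear_operatorD(1)[OF B_lin]] eE)
    moreover have "B (\<Sum>k<n. a k *\<^sub>C e k) = (\<Sum>k<n. a k *\<^sub>C B (e k))"
      by (rule linear_operator_sum[OF B_lin]) (auto simp: eE)
    ultimately show "((\<Sum>k<n. a k *\<^sub>C e k), (\<Sum>k<n. a k *\<^sub>C B (e k))) \<in> op_graph E B"
      unfolding op_graph_def by force
  next
    show "(\<lambda>n. ((\<Sum>k<n. a k *\<^sub>C e k), (\<Sum>k<n. a k *\<^sub>C B (e k)))) \<longlonglongrightarrow> (x, Y)"
      unfolding x_def Y_def
      by (intro tendsto_Pair summable_LIMSEQ x_sum summable_norm_cancel[OF abs_sum])
  qed
  then have "B x = Y" unfolding op_graph_def by auto
  moreover have "norm Y \<le> sqrt q * norm w"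
    unfolding Y_def
    by (rule order_trans[OF summable_norm[OF abs_sum] suminf_le_const[OF abs_sum partial]])
  ultimately show ?thesis using Ax x_le by (intro bexI[of _ x]) auto
qed

text \<open>
  Write \<open>Q\<close> for the inverse of \<open>A - z\<close>. Then \<open>A + B - z = (1 + B Q) (A - z)\<close>, and \<open>B Q\<close> has norm
  at most \<open>sqrt q < 1\<close>; Banach's fixed point theorem inverts the first factor.
\<close>

lemma perturbed_diagonal_invertible:
  assumes A: "diagonal s D A" and B: "closed_operator E B" and DE: "D \<subseteq> E"
    and c: "c > 0" "\<And>k. c \<le> cmod (s k - z)"
    and q: "\<And>n. (\<Sum>k<n. (norm (B (e k)))\<^sup>2 / (cmod (s k - z))\<^sup>2) \<le> q" "q < 1"
  shows "z \<in> resolvent_set D (\<lambda>x. A x + B x)"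
    and "x \<in> D \<Longrightarrow> norm x \<le> norm (A x + B x - z *\<^sub>C x) / (c * (1 - sqrt q))"
proof -
  note A_lin = diagonal_linear_operator[OF A] and D = linear_operatorD(1)
  have B_lin: "linear_operator E B" using B unfolding closed_operator_def by auto
  have q0: "0 \<le> q" using q(1)[of 0] by simp
  have q1: "sqrt q < 1" using q(2) by simp
  obtain Q where Q: "\<And>w. Q w \<in> D" "\<And>w. A (Q w) - z *\<^sub>C Q w = w"
    "\<And>w. norm (Q w) \<le> norm w / c" "\<And>w. norm (B (Q w)) \<le> sqrt q * norm w"
    using diagonal_resolvent[OF A B DE c q(1)] by metis
  have QA: "Q (A x - z *\<^sub>C x) = x" if "x \<in> D" for x
  proof -
    define y where "y = Q (A x - z *\<^sub>C x)"
    have "A y - z *\<^sub>C y = A x - z *\<^sub>C x" "y \<in> D" unfolding y_def by (simp_all add: Q)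
    then have "cinner (A y - z *\<^sub>C y) (e k) = cinner (A x - z *\<^sub>C x) (e k)" for k by simp
    then have "(s k - z) * cinner y (e k) = (s k - z) * cinner x (e k)" for k
      by (simp add: cinner_diff_left cinner_scaleC_left left_diff_distrib
          diagonalD[OF A \<open>y \<in> D\<close>] diagonalD[OF A that])
    moreover have "s k - z \<noteq> 0" for k using c(2)[of k] c(1) by auto
    ultimately have "cinner y (e k) = cinner x (e k)" for k by (simp only: mult_cancel_left) blast
    then have "y = x" by (rule eqI_coeffs)
    then show ?thesis unfolding y_def .
  qed
  have Q_diff: "Q v - Q w = Q (v - w)" for v w
  proof -
    have "A (Q v - Q w) - z *\<^sub>C (Q v - Q w) = v - w"
    proof -
      have "A (Q v - Q w) - z *\<^sub>C (Q v - Q w) = (A (Q v) - z *\<^sub>C Q v) - (A (Q w) - z *\<^sub>C Q w)"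
        by (simp add: linear_operatorD(5)[OF A_lin Q(1) Q(1)] scaleC.diff_right)
      then show ?thesis by (simp only: Q(2))
    qed
    then show ?thesis
      using QA[OF complex_vec.subspace_diff[OF D[OF A_lin] Q(1) Q(1)], of v w] by simp
  qed
  have lower: "norm x \<le> norm (A x + B x - z *\<^sub>C x) / (c * (1 - sqrt q))" if "x \<in> D" for x
  proof -
    define w where "w = A x - z *\<^sub>C x"
    have x: "x = Q w" unfolding w_def by (simp add: QA that)
    have "norm w \<le> norm (w + B x) + norm (B x)"
      by (metis add_diff_cancel_right' norm_triangle_ineq4)
    also have "norm (B x) \<le> sqrt q * norm w" unfolding x by (rule Q(4))
    finally have "norm w * (1 - sqrt q) \<le> norm (w + B x)" by (simp add: algebra_simps)
    moreover have "norm x * c \<le> norm w" using Q(3)[of w] c(1) unfolding x[symmetric]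
      by (simp add: field_simps)
    moreover from this have "norm x * c * (1 - sqrt q) \<le> norm w * (1 - sqrt q)"
      using q1 by (intro mult_right_mono) auto
    ultimately have "norm x * c * (1 - sqrt q) \<le> norm (w + B x)" by linarith
    moreover have "w + B x = A x + B x - z *\<^sub>C x" unfolding w_def by simp
    ultimately show ?thesis using c(1) q1 by (simp add: pos_le_divide_eq mult.assoc)
  qed
  then show "x \<in> D \<Longrightarrow> norm x \<le> norm (A x + B x - z *\<^sub>C x) / (c * (1 - sqrt q))" .
  show "z \<in> resolvent_set D (\<lambda>x. A x + B x)"
  proof (rule resolvent_setI[where K = "1 / (c * (1 - sqrt q))"])
    show "linear_operator D (\<lambda>x. A x + B x)"
      by (rule linear_operator_add[OF A_lin B_lin DE])
    show "norm x \<le> 1 / (c * (1 - sqrt q)) * norm (A x + B x - z *\<^sub>C x)" if "x \<in> D" for x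
      using lower[OF that] by simp
    fix y
    have "\<exists>!w. y - B (Q w) = w"
    proof (rule banach_fix_type[where c = "sqrt q"])
      show "\<forall>v w. dist (y - B (Q v)) (y - B (Q w)) \<le> sqrt q * dist v w"
      proof (intro allI)
        fix v w
        have "B (Q w) - B (Q v) = B (Q (w - v))"
          using Q(1) DE unfolding Q_diff[symmetric]
          by (subst linear_operatorD(5)[OF B_lin]) auto
        then show "dist (y - B (Q v)) (y - B (Q w)) \<le> sqrt q * dist v w"
          using Q(4)[of "w - v"] by (simp add: dist_norm norm_minus_commute)
      qed
    qed (use q0 q1 in auto)
    then obtain w where w: "y - B (Q w) = w" by blast
    have "A (Q w) + B (Q w) - z *\<^sub>C Q w = y"
      using Q(2)[of w] w by (simp add: algebra_simps)
    then show "\<exists>x\<in>D. A x + B x - z *\<^sub>C x = y" using Q(1) by blast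
  qed
qed

end

section \<open>The Fredholm alternative for finite-rank perturbations\<close>

text \<open>
  If \<open>v\<close> were not a value of \<open>g\<close>, then \<open>v\<close> and the images of \<open>S\<close> would be \<open>card S + 1\<close>
  independent vectors in the span of \<open>S\<close>.
\<close>

lemma injective_imp_surjective_on_span:
  assumes S: "finite S" "complex_vec.independent S"
    and g: "linear_operator UNIV g" "g ` S \<subseteq> complex_vec.span S"
    and inj: "\<And>x. g x = 0 \<Longrightarrow> x = 0"
    and v: "v \<in> complex_vec.span S"
  shows "\<exists>u. g u = v"
proof (rule ccontr)
  assume no: "\<not> (\<exists>u. g u = v)"
  interpret g: module_hom scaleC scaleC g
    using linear_operatorD(2,3)[OF g(1)] by unfold_locales simp_all
  have inj_g: "inj g"
    using inj by (subst g.inj_iff_eq_0) blast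
  have "v \<notin> complex_vec.span (g ` S)"
    using no unfolding g.span_image by blast
  moreover have "complex_vec.independent (g ` S)"
    using g.independent_inj_image[OF S(2) inj_g] .
  ultimately have "complex_vec.independent (insert v (g ` S))"
    by (rule complex_vec.independent_insertI)
  then have "card (insert v (g ` S)) \<le> card S"
    using complex_vec.independent_span_bound[OF S(1)] g(2) v by blast
  moreover have "card (g ` S) = card S"
    using inj_g by (metis card_image inj_on_subset subset_UNIV)
  moreover have "v \<notin> g ` S" using no by blast
  ultimately show False using S(1) by simp
qed

lemma orthonormal_independent:
  assumes "\<And>x y. x \<in> S \<Longrightarrow> y \<in> S \<Longrightarrow> cinner x y = (if x = y then 1 else 0)"
  shows "complex_vec.independent S"
proof
  assume "complex_vec.dependent S"
  then obtain x where x: "x \<in> S" "x \<in> complex_vec.span (S - {x})"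
    unfolding complex_vec.dependent_def by blast
  have "cinner x x = 0"
    by (rule cinner_span_eq_0[OF _ x(2)]) (use assms x(1) in auto)
  then show False using assms[OF x(1) x(1)] by simp
qed

context hilbert_basis begin

definition finite_diagonal :: "nat set \<Rightarrow> (nat \<Rightarrow> complex) \<Rightarrow> 'a \<Rightarrow> 'a" where
  "finite_diagonal I c x = (\<Sum>k\<in>I. (c k * cinner x (e k)) *\<^sub>C e k)"

lemma linear_operator_finite_diagonal: "linear_operator UNIV (finite_diagonal I c)"
  by (auto simp: linear_operator_def finite_diagonal_def cinner_add_left cinner_scaleC_left algebra_simps
      scaleC_add_left sum.distrib scaleC.sum_right)

text \<open>
  With \<open>R'\<close> the resolvent of \<open>A + F\<close> one has \<open>A - z = (1 - F R') (A + F - z)\<close>. The operator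
  \<open>1 - F R'\<close> is injective when \<open>z\<close> is not an eigenvalue, and it maps the finite-dimensional range
  of \<open>F\<close> into itself; so it is onto that range, and an equation \<open>u - F R' u = y\<close> is solved
  by \<open>u = y + a\<close> with \<open>a\<close> in the range of \<open>F\<close> and \<open>a - F R' a = F R' y\<close>.
\<close>

lemma finite_rank_alternative:
  assumes A: "linear_operator D A" and I: "finite I"
    and z: "z \<in> resolvent_set D (\<lambda>x. A x + finite_diagonal I c x)"
    and not_ev: "\<not> eigenvalue D A z"
  shows "z \<in> resolvent_set D A"
proof -
  define F where "F = finite_diagonal I c"
  have F: "linear_operator UNIV F" unfolding F_def by (rule linear_operator_finite_diagonal)
  have AF: "linear_operator D (\<lambda>x. A x + F x)" by (rule linear_operator_add[OF A F subset_UNIV])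
  obtain R where R: "bounded_linear R" "linear_operator UNIV R" "\<And>y. R y \<in> D"
    "\<And>y. A (R y) + F (R y) - z *\<^sub>C R y = y"
    "\<And>x. x \<in> D \<Longrightarrow> R (A x + F x - z *\<^sub>C x) = x"
    using resolvent_setE[OF AF z[folded F_def]] by metis
  define g where "g u = u - F (R u)" for u
  have g: "linear_operator UNIV g"
    by (auto simp: linear_operator_def g_def linear_operatorD(2,3)[OF F] linear_operatorD(2,3)[OF R(2)]
        scaleC.diff_right)
  have gA: "g (A x + F x - z *\<^sub>C x) = A x - z *\<^sub>C x" if "x \<in> D" for x
    using R(5)[OF that] by (simp add: g_def)
  have Ag: "A (R u) - z *\<^sub>C R u = g u" for u
    using R(4)[of u] unfolding g_def by (simp add: algebra_simps)
  have g_inj: "u = 0" if "g u = 0" for u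
  proof -
    have "A (R u) = z *\<^sub>C R u" using Ag[of u] that by simp
    then have "R u = 0" using not_ev R(3) unfolding eigenvalue_def by blast
    then show "u = 0" using R(4)[of u] linear_operatorD(4)[OF A] linear_operatorD(4)[OF F] by simp
  qed
  have g_inj': "u = v" if "g u = g v" for u v
    using g_inj[of "u - v"] that by (simp add: linear_operatorD(5)[OF g])
  have F_span: "F x \<in> complex_vec.span (e ` I)" for x
    unfolding F_def finite_diagonal_def
    by (intro complex_vec.span_sum complex_vec.span_scale complex_vec.span_base imageI)
  have e_eq: "e i = e j \<longleftrightarrow> i = j" for i j by (metis orthonormal zero_neq_one)
  have "complex_vec.independent (e ` I)"
    by (rule orthonormal_independent) (auto simp: orthonormal e_eq)
  moreover have "g ` e ` I \<subseteq> complex_vec.span (e ` I)"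
    unfolding g_def by (auto intro!: complex_vec.span_diff F_span intro: complex_vec.span_base)
  ultimately have "\<exists>u. g u = e k" if "k \<in> I" for k
    using injective_imp_surjective_on_span[OF _ _ g _ g_inj, of "e ` I" "e k"] I that
    by (auto intro: complex_vec.span_base)
  then obtain v where v: "\<And>k. k \<in> I \<Longrightarrow> g (v k) = e k" by metis
  define G where "G y = y + (\<Sum>k\<in>I. (c k * cinner (R y) (e k)) *\<^sub>C v k)" for y
  have "g (\<Sum>k\<in>I. (c k * cinner (R y) (e k)) *\<^sub>C v k) = F (R y)" for y
    by (subst linear_operator_sum[OF g I]) (auto simp: v F_def finite_diagonal_def)
  then have gG: "g (G y) = y" for y
    unfolding G_def by (simp add: linear_operatorD(2)[OF g]) (simp add: g_def)
  have "bounded_linear (\<lambda>y. R (G y))"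
    unfolding G_def
    by (intro bounded_linear_compose[OF R(1)] bounded_linear_add bounded_linear_ident
        bounded_linear_sum bounded_linear_compose[OF scaleC.bounded_linear_left]
        bounded_linear_compose[OF bounded_linear_mult_right]
        bounded_linear_compose[OF cinner.bounded_linear_left] R(1))
  moreover have "R (G (A x - z *\<^sub>C x)) = x" if "x \<in> D" for x
  proof -
    have "G (A x - z *\<^sub>C x) = A x + F x - z *\<^sub>C x"
      by (rule g_inj') (simp add: gG gA that)
    then show ?thesis by (simp add: R(5) that)
  qed
  ultimately show ?thesis
    unfolding resolvent_set_def using R(3) Ag gG by (intro CollectI exI[of _ "\<lambda>y. R (G y)"]) simp
qed

end

section \<open>Triangular orthonormal systems\<close>

text \<open>
  The head of the list is the vector added last: the vectors of every tail span a subspace that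
  is invariant under \<open>A\<close>, and the second components are the diagonal entries of the matrix of \<open>A\<close>.
\<close>

primrec triangular ::
    "'a::complex_inner set \<Rightarrow> ('a \<Rightarrow> 'a) \<Rightarrow> ('a \<times> complex) list \<Rightarrow> bool" where
  "triangular D A [] \<longleftrightarrow> True"
| "triangular D A (p # ps) \<longleftrightarrow> triangular D A ps \<and> fst p \<in> D \<and> norm (fst p) = 1 \<and>
     (\<forall>q\<in>set ps. cinner (fst p) (fst q) = 0) \<and>
     A (fst p) - snd p *\<^sub>C fst p \<in> complex_vec.span (fst ` set ps)"

lemma triangular_orthonormal:
  assumes "triangular D A ps"
  shows "\<lbrakk>x \<in> fst ` set ps; y \<in> fst ` set ps\<rbrakk> \<Longrightarrow> cinner x y = (if x = y then 1 else 0)"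
    and "card (fst ` set ps) = length ps"
proof -
  have "(\<forall>x\<in>fst ` set ps. \<forall>y\<in>fst ` set ps. cinner x y = (if x = y then 1 else 0)) \<and>
      card (fst ` set ps) = length ps"
    using assms
  proof (induction ps)
    case (Cons p ps)
    let ?x = "fst p"
    have x: "cinner ?x ?x = 1" using Cons.prems by (simp add: cinner_self)
    have orth: "cinner ?x y = 0" "cinner y ?x = 0" if "y \<in> fst ` set ps" for y
      using Cons.prems that cinner_commute[of y ?x] by auto
    have new: "?x \<notin> fst ` set ps" using orth(1)[of ?x] x by auto
    define S where "S = fst ` set ps"
    have "\<forall>x\<in>S. \<forall>y\<in>S. cinner x y = (if x = y then 1 else 0)" "card S = length ps" "finite S"
      using Cons unfolding S_def by auto
    moreover have "fst ` set (p # ps) = insert ?x S" unfolding S_def by simp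
    ultimately show ?case
      using x orth new unfolding S_def[symmetric] by auto
  qed simp
  then show "\<lbrakk>x \<in> fst ` set ps; y \<in> fst ` set ps\<rbrakk> \<Longrightarrow> cinner x y = (if x = y then 1 else 0)"
    and "card (fst ` set ps) = length ps" by blast+
qed

lemma triangular_span_invariant:
  assumes A: "linear_operator D A" and "triangular D A ps" "w \<in> complex_vec.span (fst ` set ps)"
  shows "w \<in> D \<and> A w \<in> complex_vec.span (fst ` set ps)"
  using assms(2,3)
proof (induction ps arbitrary: w)
  case Nil
  then show ?case using linear_operatorD(1,4)[OF A] by (simp add: complex_vec.subspace_0)
next
  case (Cons p ps)
  note D = linear_operatorD(1)[OF A]
  let ?S = "fst ` set ps" and ?x = "fst p"
  have mono: "complex_vec.span ?S \<subseteq> complex_vec.span (insert ?x ?S)"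
    by (rule complex_vec.span_mono) blast
  obtain k where k: "w - k *\<^sub>C ?x \<in> complex_vec.span ?S"
    using Cons.prems(2) by (auto simp: complex_vec.span_breakdown_eq)
  have x: "?x \<in> D" using Cons.prems by simp
  have x_in: "?x \<in> complex_vec.span (insert ?x ?S)" by (simp add: complex_vec.span_base)
  have IH: "w - k *\<^sub>C ?x \<in> D" "A (w - k *\<^sub>C ?x) \<in> complex_vec.span ?S"
    using Cons.IH[OF _ k] Cons.prems by auto
  have w: "w = (w - k *\<^sub>C ?x) + k *\<^sub>C ?x" by simp
  have "w \<in> D"
    using complex_vec.subspace_add[OF D IH(1) complex_vec.subspace_scale[OF D x, of k]] by simp
  moreover have "A w = A (w - k *\<^sub>C ?x) + k *\<^sub>C A ?x"
    using linear_operatorD(2)[OF A IH(1) complex_vec.subspace_scale[OF D x, of k]]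
    by (simp add: linear_operatorD(3)[OF A x])
  moreover have "(A ?x - snd p *\<^sub>C ?x) + snd p *\<^sub>C ?x \<in> complex_vec.span (insert ?x ?S)"
    using Cons.prems(1) mono x_in
    by (intro complex_vec.span_add complex_vec.span_scale) auto
  then have "A ?x \<in> complex_vec.span (insert ?x ?S)" by simp
  ultimately show ?case
    using IH(2) mono by (auto intro!: complex_vec.span_add complex_vec.span_scale)
qed

text \<open>The Gram-Schmidt step.\<close>

lemma triangular_projection:
  assumes "triangular D A ps"
  shows "\<exists>w\<in>complex_vec.span (fst ` set ps). \<forall>q\<in>set ps. cinner (y - w) (fst q) = 0"
  using assms
proof (induction ps)
  case Nil
  then show ?case by simp
next
  case (Cons p ps)
  let ?S = "fst ` set ps" and ?x = "fst p"
  obtain w where w: "w \<in> complex_vec.span ?S" "\<forall>q\<in>set ps. cinner (y - w) (fst q) = 0"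
    using Cons by auto
  define v where "v = w + cinner y ?x *\<^sub>C ?x"
  have "v \<in> complex_vec.span (insert ?x ?S)"
    unfolding v_def
    by (intro complex_vec.span_add complex_vec.span_scale
        subsetD[OF complex_vec.span_mono[OF subset_insertI] w(1)] complex_vec.span_base insertI1)
  moreover have "cinner ?x w = 0"
    by (rule cinner_span_eq_0[OF _ w(1)]) (use Cons.prems in auto)
  then have "cinner w ?x = 0" by (metis cinner_commute complex_cnj_zero)
  then have "cinner (y - v) ?x = 0"
    using Cons.prems
    by (simp add: v_def cinner_diff_left cinner_add_left cinner_scaleC_left cinner_self)
  moreover have "cinner (y - v) (fst q) = 0" if "q \<in> set ps" for q
    using Cons.prems w(2) that
    by (simp add: v_def cinner_diff_left cinner_add_left cinner_scaleC_left)
  ultimately show ?case by (intro bexI[of _ v]) auto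
qed

lemma triangular_extend:
  assumes A: "linear_operator D A" and ps: "triangular D A ps"
    and y: "y \<in> D" "y \<notin> complex_vec.span (fst ` set ps)"
    and Ay: "A y - z *\<^sub>C y \<in> complex_vec.span (fst ` set ps)"
  shows "\<exists>x. triangular D A ((x, z) # ps)"
proof -
  note D = linear_operatorD(1)[OF A]
  let ?W = "complex_vec.span (fst ` set ps)"
  obtain w where w: "w \<in> ?W" "\<And>q. q \<in> set ps \<Longrightarrow> cinner (y - w) (fst q) = 0"
    using triangular_projection[OF ps] by blast
  have wD: "w \<in> D" and Aw: "A w \<in> ?W" using triangular_span_invariant[OF A ps w(1)] by auto
  define u where "u = y - w"
  have u0: "u \<noteq> 0" using y(2) w(1) unfolding u_def by auto
  have uD: "u \<in> D" unfolding u_def by (rule complex_vec.subspace_diff[OF D y(1) wD])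
  have "A u - z *\<^sub>C u = (A y - z *\<^sub>C y) - (A w - z *\<^sub>C w)"
    unfolding u_def by (simp add: linear_operatorD(5)[OF A y(1) wD] scaleC.diff_right)
  then have Au: "A u - z *\<^sub>C u \<in> ?W"
    using Ay Aw w(1) by (simp add: complex_vec.span_diff complex_vec.span_scale)
  define a where "a = complex_of_real (1 / norm u)"
  have "A (a *\<^sub>C u) - z *\<^sub>C a *\<^sub>C u = a *\<^sub>C (A u - z *\<^sub>C u)"
    by (simp add: linear_operatorD(3)[OF A uD] scaleC.diff_right mult.commute)
  then have "A (a *\<^sub>C u) - z *\<^sub>C a *\<^sub>C u \<in> ?W"
    using Au by (simp add: complex_vec.span_scale)
  moreover have "norm (a *\<^sub>C u) = 1"
    using u0 by (simp add: norm_scaleC a_def norm_divide)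
  moreover have "cinner (a *\<^sub>C u) (fst q) = 0" if "q \<in> set ps" for q
    using w(2)[OF that] by (simp add: u_def cinner_scaleC_left)
  ultimately have "triangular D A ((a *\<^sub>C u, z) # ps)"
    using ps complex_vec.subspace_scale[OF D uD] by simp
  then show ?thesis by blast
qed

text \<open>
  The diagonal entries of a triangular matrix are its only eigenvalues. Hence an eigenvector for
  any other eigenvalue extends the system.
\<close>

lemma triangular_eigenvalue:
  assumes A: "linear_operator D A" and "triangular D A ps"
    and "x \<in> complex_vec.span (fst ` set ps)" "x \<noteq> 0" "A x = z *\<^sub>C x"
  shows "z \<in> snd ` set ps"
  using assms(2-)
proof (induction ps)
  case (Cons p ps)
  let ?S = "fst ` set ps" and ?y = "fst p"
  obtain k where k: "x - k *\<^sub>C ?y \<in> complex_vec.span ?S"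
    using Cons.prems(2) by (auto simp: complex_vec.span_breakdown_eq)
  define w where "w = x - k *\<^sub>C ?y"
  have ps: "triangular D A ps" and y: "?y \<in> D" using Cons.prems by auto
  note D = linear_operatorD(1)[OF A]
  have w: "w \<in> D" "A w \<in> complex_vec.span ?S" "w \<in> complex_vec.span ?S"
    using triangular_span_invariant[OF A ps k] k unfolding w_def by auto
  have x: "x = w + k *\<^sub>C ?y" unfolding w_def by simp
  have "A x = A w + k *\<^sub>C A ?y"
    unfolding x by (simp add: linear_operatorD(2)[OF A w(1)] linear_operatorD(3)[OF A y]
        complex_vec.subspace_scale[OF D y])
  then have eq: "(k * (z - snd p)) *\<^sub>C ?y
      = A w - z *\<^sub>C w + k *\<^sub>C (A ?y - snd p *\<^sub>C ?y)"
    using Cons.prems(4) unfolding x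
    by (simp add: scaleC_add_right scaleC.diff_right scaleC.diff_left algebra_simps)
  have "(k * (z - snd p)) *\<^sub>C ?y \<in> complex_vec.span ?S"
    unfolding eq using Cons.prems(1)
    by (intro complex_vec.span_add complex_vec.span_scale[of "A ?y - snd p *\<^sub>C ?y"]
        complex_vec.span_diff[OF w(2) complex_vec.span_scale[OF w(3)]]) simp
  then have "cinner ?y ((k * (z - snd p)) *\<^sub>C ?y) = 0"
    by (rule cinner_span_eq_0[rotated]) (use Cons.prems in auto)
  then have "k = 0 \<or> z = snd p"
    using Cons.prems(1) by (auto simp: cinner_scaleC_right cinner_self)
  then show ?case
  proof
    assume "k = 0"
    then have "z \<in> snd ` set ps" using Cons.IH[OF ps _ Cons.prems(3,4)] k by simp
    then show ?thesis by simp
  qed simp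
qed simp

text \<open>
  On the invariant subspace spanned by a tail, \<open>R\<close> inverts the triangular matrix of \<open>A - z0\<close>. So
  it is triangular in the same system, and its diagonal entries are the reciprocals.
\<close>

lemma triangular_resolvent:
  assumes R: "linear_operator UNIV R" "\<And>x. x \<in> D \<Longrightarrow> R (A x - z0 *\<^sub>C x) = x"
    and "triangular D A ps"
  shows "(\<forall>w\<in>complex_vec.span (fst ` set ps). R w \<in> complex_vec.span (fst ` set ps)) \<and>
    (\<forall>q\<in>set ps. snd q \<noteq> z0 \<and> cinner (R (fst q)) (fst q) = 1 / (snd q - z0))"
  using assms(3)
proof (induction ps)
  case Nil
  then show ?case by (simp add: linear_operatorD(4)[OF R(1)])
next
  case (Cons p ps)
  let ?S = "fst ` set ps" and ?x = "fst p"
  have IH: "\<And>w. w \<in> complex_vec.span ?S \<Longrightarrow> R w \<in> complex_vec.span ?S"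
    "\<And>q. q \<in> set ps \<Longrightarrow> snd q \<noteq> z0 \<and> cinner (R (fst q)) (fst q) = 1 / (snd q - z0)"
    using Cons by auto
  define w where "w = A ?x - snd p *\<^sub>C ?x"
  have w: "w \<in> complex_vec.span ?S" using Cons.prems unfolding w_def by simp
  have "A ?x - z0 *\<^sub>C ?x = (snd p - z0) *\<^sub>C ?x + w"
    unfolding w_def by (simp add: scaleC.diff_left)
  then have x: "?x = (snd p - z0) *\<^sub>C R ?x + R w"
    using R(2)[of ?x] Cons.prems by (simp add: linear_operatorD(2,3)[OF R(1)])
  have "cinner ?x (R w) = 0"
    by (rule cinner_span_eq_0[OF _ IH(1)[OF w]]) (use Cons.prems in auto)
  then have Rw: "cinner (R w) ?x = 0" by (metis cinner_commute complex_cnj_zero)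
  have "cinner ?x ?x = (snd p - z0) * cinner (R ?x) ?x + cinner (R w) ?x"
    by (metis x cinner_add_left cinner_scaleC_left)
  then have "(snd p - z0) * cinner (R ?x) ?x = 1"
    using Cons.prems by (simp add: Rw cinner_self)
  moreover from this have "snd p - z0 \<noteq> 0" by auto
  ultimately have p: "snd p \<noteq> z0" "cinner (R ?x) ?x = 1 / (snd p - z0)"
    by (auto simp: nonzero_eq_divide_eq mult.commute)
  have mono: "complex_vec.span ?S \<subseteq> complex_vec.span (insert ?x ?S)"
    by (rule complex_vec.span_mono) blast
  have "(snd p - z0) *\<^sub>C R ?x = ?x - R w" by (metis x add_diff_cancel_right')
  then have "R ?x = (1 / (snd p - z0)) *\<^sub>C (?x - R w)"
    using p(1) by (metis complex_vec.scale_scale complex_vec.scale_one nonzero_eq_divide_eq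
        right_minus_eq)
  then have Rx: "R ?x \<in> complex_vec.span (insert ?x ?S)"
    using IH(1)[OF w] mono
    by (auto intro!: complex_vec.span_scale complex_vec.span_diff intro: complex_vec.span_base)
  have "R v \<in> complex_vec.span (insert ?x ?S)" if v: "v \<in> complex_vec.span (insert ?x ?S)" for v
  proof -
    obtain k where k: "v - k *\<^sub>C ?x \<in> complex_vec.span ?S"
      using v by (auto simp: complex_vec.span_breakdown_eq)
    have "R v = R (v - k *\<^sub>C ?x) + k *\<^sub>C R ?x"
      by (simp add: linear_operatorD(3,5)[OF R(1)])
    then show ?thesis
      using IH(1)[OF k] mono Rx by (auto intro!: complex_vec.span_add complex_vec.span_scale)
  qed
  then show ?case using IH(2) p by auto
qed

section \<open>Discreteness of the spectrum\<close>

context hilbert_basis begin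

text \<open>
  The resolvent at \<open>z0\<close> differs by a finite-rank operator from one of norm at most \<open>1 / (2 r)\<close>. If
  \<open>x\<close> runs through a triangular system, the numbers \<open>\<langle>R x, x\<rangle>\<close> have modulus at least \<open>1 / r\<close>,
  while by Bessel's inequality the finite-rank part contributes a bounded amount to the sum of
  their moduli. So the system has bounded length.
\<close>

lemma triangular_length_bound:
  assumes A: "linear_operator D A" and z0: "z0 \<in> resolvent_set D A"
    and I: "finite I" and z0': "z0 \<in> resolvent_set D (\<lambda>x. A x + finite_diagonal I c x)"
    and r: "r > 0"
    and lower: "\<And>x. x \<in> D \<Longrightarrow> norm x \<le> 1 / (2 * r) * norm (A x + finite_diagonal I c x - z0 *\<^sub>C x)"
  shows "\<exists>n. \<forall>ps. triangular D A ps \<and> (\<forall>q\<in>set ps. cmod (snd q - z0) \<le> r) \<longrightarrow> length ps \<le> n"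
proof -
  define F where "F = finite_diagonal I c"
  have F: "linear_operator UNIV F" unfolding F_def by (rule linear_operator_finite_diagonal)
  have AF: "linear_operator D (\<lambda>x. A x + F x)" by (rule linear_operator_add[OF A F subset_UNIV])
  obtain R where R: "linear_operator UNIV R" "\<And>x. x \<in> D \<Longrightarrow> R (A x - z0 *\<^sub>C x) = x"
    using resolvent_setE[OF A z0] by metis
  obtain R' where R': "linear_operator UNIV R'" "\<And>y. R' y \<in> D"
    "\<And>y. A (R' y) + F (R' y) - z0 *\<^sub>C R' y = y"
    using resolvent_setE[OF AF z0'[folded F_def]] by metis
  have R'_bound: "norm (R' y) \<le> 1 / (2 * r) * norm y" for y
    using lower[OF R'(2), of y] by (simp add: R'(3) F_def[symmetric])
  define f where "f k y = c k * cinner (R' y) (e k)" for k y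
  define C where "C = (\<Sum>k\<in>I. (cmod (c k) * (1 / (2 * r)))\<^sup>2 + (norm (R (e k)))\<^sup>2)"
  have R_eq: "R y = R' y + (\<Sum>k\<in>I. f k y *\<^sub>C R (e k))" for y
  proof -
    have y: "y = (A (R' y) - z0 *\<^sub>C R' y) + F (R' y)"
      using R'(3)[of y] by (simp add: algebra_simps)
    have "R y = R (A (R' y) - z0 *\<^sub>C R' y) + R (F (R' y))"
      by (subst y) (simp add: linear_operatorD(2)[OF R(1)])
    also have "R (F (R' y)) = (\<Sum>k\<in>I. f k y *\<^sub>C R (e k))"
      unfolding F_def finite_diagonal_def f_def by (rule linear_operator_sum[OF R(1) I]) simp
    finally show ?thesis by (simp add: R(2) R'(2))
  qed
  have f_bound: "cmod (f k y) \<le> (cmod (c k) * (1 / (2 * r))) * norm y" for k y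
    using Cauchy_Schwarz_cinner[of "R' y" "e k"] R'_bound[of y]
      mult_left_mono[of "cmod (cinner (R' y) (e k))" "1 / (2 * r) * norm y" "cmod (c k)"]
    by (simp add: f_def norm_mult)
  have "length ps \<le> nat \<lceil>r * C\<rceil>"
    if ps: "triangular D A ps" and near: "\<forall>q\<in>set ps. cmod (snd q - z0) \<le> r" for ps
  proof -
    define X where "X = fst ` set ps"
    have X: "finite X" unfolding X_def by simp
    note on = triangular_orthonormal(1)[OF ps, folded X_def]
    have pointwise: "1 / (2 * r)
        \<le> (\<Sum>k\<in>I. ((cmod (f k x))\<^sup>2 + (cmod (cinner (R (e k)) x))\<^sup>2) / 2)" if "x \<in> X" for x
    proof -
      obtain q where q: "q \<in> set ps" "x = fst q" using \<open>x \<in> X\<close> unfolding X_def by blast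
      have Rx: "snd q \<noteq> z0" "cinner (R x) x = 1 / (snd q - z0)"
        using triangular_resolvent[OF R ps] q by auto
      have x1: "norm x = 1" using on[OF that that] by (simp add: norm_eq_sqrt_cinner)
      have "1 / r \<le> cmod (cinner (R x) x)"
        using near q(1) Rx r by (auto simp: norm_divide intro!: divide_left_mono)
      also have "\<dots> \<le> cmod (cinner (R' x) x) + (\<Sum>k\<in>I. cmod (f k x * cinner (R (e k)) x))"
        by (simp add: R_eq[of x] cinner_add_left cinner.sum_left cinner_scaleC_left)
          (intro norm_triangle_le add_left_mono norm_sum)
      also have "cmod (cinner (R' x) x) \<le> 1 / (2 * r)"
        using Cauchy_Schwarz_cinner[of "R' x" x] R'_bound[of x] x1 by simp
      also have "(\<Sum>k\<in>I. cmod (f k x * cinner (R (e k)) x))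
          \<le> (\<Sum>k\<in>I. ((cmod (f k x))\<^sup>2 + (cmod (cinner (R (e k)) x))\<^sup>2) / 2)"
      proof (rule sum_mono)
        fix k
        show "cmod (f k x * cinner (R (e k)) x)
            \<le> ((cmod (f k x))\<^sup>2 + (cmod (cinner (R (e k)) x))\<^sup>2) / 2"
          using sum_squares_bound[of "cmod (f k x)" "cmod (cinner (R (e k)) x)"]
          by (simp add: norm_mult)
      qed
      finally show ?thesis using r by (simp add: field_simps)
    qed
    have "card X / (2 * r) = (\<Sum>x\<in>X. 1 / (2 * r))" by simp
    also have "\<dots> \<le> (\<Sum>x\<in>X. \<Sum>k\<in>I. ((cmod (f k x))\<^sup>2 + (cmod (cinner (R (e k)) x))\<^sup>2) / 2)"
      by (rule sum_mono) (rule pointwise)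
    also have "\<dots> = (\<Sum>k\<in>I. ((\<Sum>x\<in>X. (cmod (f k x))\<^sup>2)
        + (\<Sum>x\<in>X. (cmod (cinner (R (e k)) x))\<^sup>2)) / 2)"
      by (subst sum.swap) (simp add: sum_divide_distrib sum.distrib add_divide_distrib)
    also have "\<dots> \<le> (\<Sum>k\<in>I. ((cmod (c k) * (1 / (2 * r)))\<^sup>2 + (norm (R (e k)))\<^sup>2) / 2)"
    proof (intro sum_mono divide_right_mono add_mono)
      fix k
      show "(\<Sum>x\<in>X. (cmod (f k x))\<^sup>2) \<le> (cmod (c k) * (1 / (2 * r)))\<^sup>2"
      proof (rule Bessel_functional[OF X on])
        show "f k (x + y) = f k x + f k y" "f k (a *\<^sub>C x) = a * f k x" for x y a
          by (simp_all add: f_def linear_operatorD(2,3)[OF R'(1)] cinner_add_left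
              cinner_scaleC_left algebra_simps)
      qed (simp_all only: f_bound)
      have "(\<Sum>x\<in>X. (cmod (cnj (cinner (R (e k)) x)))\<^sup>2) \<le> (norm (R (e k)))\<^sup>2"
        by (rule Bessel_functional[OF X on])
          (auto simp: cinner_add_right cinner_scaleC_right Cauchy_Schwarz_cinner)
      then show "(\<Sum>x\<in>X. (cmod (cinner (R (e k)) x))\<^sup>2) \<le> (norm (R (e k)))\<^sup>2" by simp
    qed simp
    also have "\<dots> = C / 2" unfolding C_def by (rule sum_divide_distrib[symmetric])
    finally have "card X \<le> r * C" using r by (simp add: field_simps)
    then have "length ps \<le> r * C" using triangular_orthonormal(2)[OF ps] by (simp add: X_def)
    then show ?thesis by linarith
  qed
  then show ?thesis by blast
qed

text \<open>
  The hypothesis \<open>far\<close> replaces compactness of the resolvent. Infinitely many eigenvalues in a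
  disc, or an infinite-dimensional root subspace, would give triangular systems of every
  length with diagonal entries in a fixed disc.
\<close>

lemma discrete_spectrumI:
  assumes A: "linear_operator D A" and z0: "z0 \<in> resolvent_set D A"
    and far: "\<And>z r. r > 0 \<Longrightarrow> \<exists>I c. finite I \<and>
      z \<in> resolvent_set D (\<lambda>x. A x + finite_diagonal I c x) \<and>
      (\<forall>x\<in>D. norm x \<le> 1 / (2 * r) * norm (A x + finite_diagonal I c x - z *\<^sub>C x))"
  shows "discrete_spectrum D A"
proof -
  have bound: "\<exists>n. \<forall>ps. triangular D A ps \<and> snd ` set ps \<subseteq> Z \<longrightarrow> length ps \<le> n"
    if Z: "Z \<subseteq> cball z0 r" and r: "r > 0" for Z r
  proof -
    obtain I c where "finite I" "z0 \<in> resolvent_set D (\<lambda>x. A x + finite_diagonal I c x)"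
      "\<And>x. x \<in> D \<Longrightarrow> norm x \<le> 1 / (2 * r) * norm (A x + finite_diagonal I c x - z0 *\<^sub>C x)"
      using far[OF r] by meson
    then obtain n where n: "\<And>ps. triangular D A ps \<Longrightarrow> \<forall>q\<in>set ps. cmod (snd q - z0) \<le> r
        \<Longrightarrow> length ps \<le> n"
      using triangular_length_bound[OF A z0 _ _ r] by meson
    have "cmod (snd q - z0) \<le> r" if "snd ` set ps \<subseteq> Z" "q \<in> set ps" for q ps
    proof -
      have "snd q \<in> cball z0 r" using that Z by blast
      then show ?thesis by (simp add: dist_norm norm_minus_commute)
    qed
    then have "triangular D A ps \<and> snd ` set ps \<subseteq> Z \<longrightarrow> length ps \<le> n" for ps
      using n[of ps] by meson
    then show ?thesis by blast
  qed
  have unbounded: False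
    if Z: "Z \<subseteq> cball z0 r" "r > 0"
      and step: "\<And>ps. triangular D A ps \<Longrightarrow> snd ` set ps \<subseteq> Z \<Longrightarrow>
        \<exists>z\<in>Z. \<exists>y\<in>D. y \<notin> complex_vec.span (fst ` set ps) \<and>
          A y - z *\<^sub>C y \<in> complex_vec.span (fst ` set ps)" for Z r
  proof -
    have "\<exists>ps. triangular D A ps \<and> snd ` set ps \<subseteq> Z \<and> length ps = n" for n
    proof (induction n)
      case 0
      show ?case by (rule exI[of _ "[]"]) simp
    next
      case (Suc n)
      then obtain ps where ps: "triangular D A ps" "snd ` set ps \<subseteq> Z" "length ps = n" by blast
      obtain z x where "z \<in> Z" "triangular D A ((x, z) # ps)"
        using step[OF ps(1,2)] triangular_extend[OF A ps(1)] by blast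
      then show ?case using ps by (intro exI[of _ "(x, z) # ps"]) auto
    qed
    then show False using bound[OF Z] by (metis Suc_n_not_le_n)
  qed
  have ev: "eigenvalue D A z" if "z \<in> spectrum D A" for z
  proof -
    obtain I c where "finite I" "z \<in> resolvent_set D (\<lambda>x. A x + finite_diagonal I c x)"
      using far[OF zero_less_one, of z] by blast
    then show ?thesis
      using finite_rank_alternative[OF A] that unfolding spectrum_def by blast
  qed
  have fin: "finite {z \<in> spectrum D A. z \<in> cball z0 r}" (is "finite ?Z") if r: "r > 0" for r
  proof (rule ccontr)
    assume inf: "infinite ?Z"
    show False
    proof (rule unbounded[of ?Z r])
      fix ps assume ps: "triangular D A ps" "snd ` set ps \<subseteq> ?Z"
      obtain z where z: "z \<in> ?Z" "z \<notin> snd ` set ps"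
        using finite_subset[of ?Z "snd ` set ps"] inf by auto
      obtain x where x: "x \<in> D" "x \<noteq> 0" "A x = z *\<^sub>C x"
        using ev z(1) unfolding eigenvalue_def by blast
      then have "x \<notin> complex_vec.span (fst ` set ps)"
        using triangular_eigenvalue[OF A ps(1)] z(2) by blast
      then show "\<exists>z\<in>?Z. \<exists>y\<in>D. y \<notin> complex_vec.span (fst ` set ps) \<and>
          A y - z *\<^sub>C y \<in> complex_vec.span (fst ` set ps)"
        using z(1) x by (intro bexI[of _ z] bexI[of _ x]) (auto simp: complex_vec.span_zero)
    qed (use r in auto)
  qed
  have iso: "z isolated_in spectrum D A" if "z \<in> spectrum D A" for z
  proof -
    define Z where "Z = {w \<in> spectrum D A. w \<in> cball z0 (dist z0 z + 1)} - {z}"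
    have "open (ball z0 (dist z0 z + 1) - Z)"
      unfolding Z_def by (intro open_Diff open_ball finite_imp_closed finite_Diff fin) (simp add: add_nonneg_pos)
    moreover have "(ball z0 (dist z0 z + 1) - Z) \<inter> spectrum D A = {z}"
      using that unfolding Z_def by auto
    ultimately show ?thesis using that unfolding isolated_in_def by blast
  qed
  have "finite_alg_mult D A z" for z
  proof (rule ccontr)
    assume inf: "\<not> finite_alg_mult D A z"
    show False
    proof (rule unbounded[of "{z}" "dist z0 z + 1"])
      fix ps assume ps: "triangular D A ps" "snd ` set ps \<subseteq> {z}"
      let ?W = "complex_vec.span (fst ` set ps)"
      obtain x n where x: "x \<in> ker_power D A z n" "x \<notin> ?W"
        using inf unfolding finite_alg_mult_def root_subspace_def by blast
      have "\<exists>y\<in>D. y \<notin> ?W \<and> A y - z *\<^sub>C y \<in> ?W"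
        using x
      proof (induction n arbitrary: x)
        case 0
        then show ?case by (simp add: complex_vec.span_zero)
      next
        case (Suc n)
        then show ?case by (cases "A x - z *\<^sub>C x \<in> ?W") auto
      qed
      then show "\<exists>z\<in>{z}. \<exists>y\<in>D. y \<notin> ?W \<and> A y - z *\<^sub>C y \<in> ?W" by blast
    qed (auto simp: add_nonneg_pos)
  qed
  then show ?thesis unfolding discrete_spectrum_def using ev iso by blast
qed

end

section \<open>Sums over points with gaps\<close>

lemma sum_lessThan_add: "(\<Sum>k<m + n. g k) = (\<Sum>k<m. g k) + (\<Sum>k<n. g (m + k :: nat))"
  for g :: "nat \<Rightarrow> real"
  by (induction n) (simp_all add: add.assoc)

lemma sum_div_le:
  fixes g :: "nat \<Rightarrow> real"
  assumes "p \<ge> 1" "summable g" "\<And>i. g i \<ge> 0"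
  shows "(\<Sum>m<n. g (m div p)) \<le> real p * suminf g"
proof -
  have block: "(\<Sum>m\<in>{i * p..<i * p + p}. g (m div p)) = real p * g i" for i
  proof -
    have "m div p = i" if "m \<in> {i * p..<i * p + p}" for m
      using that assms(1) by (intro div_nat_eqI) (auto simp: mult.commute)
    then have "(\<Sum>m\<in>{i * p..<i * p + p}. g (m div p)) = (\<Sum>m\<in>{i * p..<i * p + p}. g i)"
      by (intro sum.cong) auto
    then show ?thesis by simp
  qed
  have "n \<le> n * p" using assms(1) by simp
  then have "(\<Sum>m<n. g (m div p)) \<le> (\<Sum>m<n * p. g (m div p))"
    by (intro sum_mono2) (auto simp: assms(3))
  also have "\<dots> = (\<Sum>i<n. real p * g i)"
    unfolding sum.nat_group[symmetric] by (rule sum.cong[OF refl block])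
  also have "\<dots> \<le> real p * suminf g"
    unfolding sum_distrib_left[symmetric]
    by (intro mult_left_mono sum_le_suminf assms) auto
  finally show ?thesis .
qed

lemma summable_inverse_quadratic:
  fixes b d :: real
  assumes "d > 0"
  shows "summable (\<lambda>i. 1 / (b\<^sup>2 + (real i * d)\<^sup>2))"
proof (rule summable_comparison_test')
  show "summable (\<lambda>i. inverse (real i ^ 2) / d\<^sup>2)"
    by (intro summable_divide inverse_power_summable) simp
  fix i :: nat assume "1 \<le> i"
  then have "1 / (b\<^sup>2 + (real i * d)\<^sup>2) \<le> 1 / (real i * d)\<^sup>2"
    using assms by (intro divide_left_mono mult_pos_pos add_nonneg_pos) auto
  then show "norm (1 / (b\<^sup>2 + (real i * d)\<^sup>2)) \<le> inverse (real i ^ 2) / d\<^sup>2"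
    by (simp add: power_mult_distrib field_simps)
qed

locale gapped_sequence =
  fixes u :: "nat \<Rightarrow> real" and p :: nat and d :: real
  assumes increasing: "u k < u (Suc k)" and gap: "u (k + p) - u k > d"
    and p: "p \<ge> 1" and d: "d > 0"
begin

lemma u_mono: "i \<le> j \<Longrightarrow> u i \<le> u j"
  by (rule lift_Suc_mono_le[of u]) (simp add: less_imp_le increasing)

lemma gap_div: "u (k + m) - u k \<ge> real (m div p) * d"
proof -
  have "u (k + j * p) - u k \<ge> real j * d" for j
  proof (induction j)
    case (Suc j)
    then show ?case using gap[of "k + j * p"] by (simp add: algebra_simps)
  qed simp
  moreover have "u (k + (m div p) * p) \<le> u (k + m)" by (rule u_mono) simp
  ultimately show ?thesis by (meson diff_right_mono order_trans)
qed

lemma u_at_top: "filterlim u at_top sequentially"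
proof (rule filterlim_at_top[THEN iffD2], intro allI)
  fix x
  obtain j where j: "(x - u 0) / d \<le> real j" using real_arch_simple by blast
  have "x \<le> u m" if "m \<ge> j * p" for m
  proof -
    have "(x - u 0) \<le> real j * d" using j d by (simp add: field_simps)
    also have "\<dots> \<le> u (j * p) - u 0"
      using gap_div[of "j * p" 0] p by simp
    also have "\<dots> \<le> u m - u 0" using u_mono[OF that] by simp
    finally show ?thesis by simp
  qed
  then show "\<forall>\<^sub>F k in sequentially. x \<le> u k" unfolding eventually_sequentially by blast
qed

text \<open>
  Counted from \<open>a\<close> in either direction, the point with number \<open>m\<close> has distance at least
  \<open>(m div p) d\<close> from \<open>a\<close>.
\<close>

lemma sum_inverse_quadratic_le:
  assumes b: "b \<noteq> 0"
  shows "(\<Sum>k<n. 1 / (b\<^sup>2 + (u k - a)\<^sup>2)) \<le> 2 * real p * (\<Sum>i. 1 / (b\<^sup>2 + (real i * d)\<^sup>2))"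
proof -
  define g where "g i = 1 / (b\<^sup>2 + (real i * d)\<^sup>2)" for i
  define f where "f k = 1 / (b\<^sup>2 + (u k - a)\<^sup>2)" for k
  have g: "summable g" "\<And>i. g i \<ge> 0"
    unfolding g_def by (rule summable_inverse_quadratic[OF d]) simp
  have f_le: "f k \<le> g i" if "real i * d \<le> \<bar>u k - a\<bar>" for k i
  proof -
    have "(real i * d)\<^sup>2 \<le> (u k - a)\<^sup>2"
      using power_mono[OF that, of 2] d by simp
    then show ?thesis
      unfolding f_def g_def using b by (intro divide_left_mono mult_pos_pos add_pos_nonneg) auto
  qed
  have ex: "\<exists>k. a \<le> u k"
    using u_at_top by (auto simp: filterlim_at_top eventually_sequentially)
  define k0 where "k0 = (LEAST k. a \<le> u k)"
  have right: "a \<le> u k0" unfolding k0_def by (rule LeastI_ex[OF ex])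
  have left: "u k < a" if "k < k0" for k
    using not_less_Least[OF that[unfolded k0_def]] by simp
  have "(\<Sum>k<n. f k) \<le> (\<Sum>k<k0 + n. f k)"
    by (intro sum_mono2) (auto simp: f_def)
  also have "\<dots> = (\<Sum>m<k0. f (k0 - Suc m)) + (\<Sum>m<n. f (k0 + m))"
    unfolding sum_lessThan_add by (simp add: sum.nat_diff_reindex)
  also have "\<dots> \<le> (\<Sum>m<k0. g (m div p)) + (\<Sum>m<n. g (m div p))"
  proof (intro add_mono sum_mono f_le)
    fix m assume "m \<in> {..<k0}"
    then have m: "k0 - Suc m + m = k0 - 1" "k0 - 1 < k0" by auto
    show "real (m div p) * d \<le> \<bar>u (k0 - Suc m) - a\<bar>"
      using gap_div[of m "k0 - Suc m"] left[OF m(2)] unfolding m(1) by linarith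
  next
    fix m
    show "real (m div p) * d \<le> \<bar>u (k0 + m) - a\<bar>"
      using gap_div[of m k0] right by linarith
  qed
  also have "\<dots> \<le> real p * suminf g + real p * suminf g"
    by (intro add_mono sum_div_le p g)
  finally show ?thesis unfolding f_def g_def by simp
qed

lemma weighted_sum_le:
  assumes b: "b \<noteq> 0" and w: "\<And>k. 0 \<le> w k" "\<And>k. w k \<le> S"
    and D: "\<And>k. b\<^sup>2 + (u k - a)\<^sup>2 \<le> D k"
  shows "(\<Sum>k<n. w k / D k) \<le> S * (2 * real p * (\<Sum>i. 1 / (b\<^sup>2 + (real i * d)\<^sup>2)))"
proof -
  have S: "0 \<le> S" using order_trans[OF w] .
  have pos: "0 < b\<^sup>2 + (u k - a)\<^sup>2" for k using b by (simp add: add_pos_nonneg)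
  have "w k / D k \<le> S * (1 / (b\<^sup>2 + (u k - a)\<^sup>2))" for k
    using frac_le[OF S w(2) pos D] by simp
  then have "(\<Sum>k<n. w k / D k) \<le> S * (\<Sum>k<n. 1 / (b\<^sup>2 + (u k - a)\<^sup>2))"
    unfolding sum_distrib_left by (rule sum_mono)
  also have "\<dots> \<le> S * (2 * real p * (\<Sum>i. 1 / (b\<^sup>2 + (real i * d)\<^sup>2)))"
    by (rule mult_left_mono[OF sum_inverse_quadratic_le[OF b] S])
  finally show ?thesis .
qed

text \<open>
  The gaps between \<open>a\<close> and the points below it shift the summation index by \<open>N + 1\<close>; this produces
  the tail of \<open>\<Sum> 1 / j\<^sup>2\<close>.
\<close>

lemma far_sum_le:
  assumes l: "0 < l" "l \<le> d" and a: "m \<ge> 1 \<Longrightarrow> u (m - 1) + real (N + 1) * l \<le> a"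
  shows "(\<Sum>k<m. 1 / (a - u k)\<^sup>2) \<le> real p * (\<Sum>j. 1 / (real (N + 1 + j))\<^sup>2) / l\<^sup>2"
proof -
  define g where "g j = 1 / (real (N + 1 + j))\<^sup>2" for j
  have "summable (\<lambda>j. inverse (real (j + (N + 1)) ^ 2))"
    by (intro summable_ignore_initial_segment inverse_power_summable) simp
  then have g: "summable g" "\<And>j. g j \<ge> 0"
    by (simp_all add: g_def[abs_def] inverse_eq_divide add_ac)
  have "(\<Sum>k<m. 1 / (a - u k)\<^sup>2) = (\<Sum>i<m. 1 / (a - u (m - Suc i))\<^sup>2)"
    by (rule sum.nat_diff_reindex[symmetric])
  also have "\<dots> \<le> (\<Sum>i<m. g (i div p) / l\<^sup>2)"
  proof (rule sum_mono)
    fix i assume "i \<in> {..<m}"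
    then have m: "m - Suc i + i = m - 1" "m \<ge> 1" by auto
    have "real (i div p) * l \<le> real (i div p) * d" using l by (intro mult_left_mono) auto
    also have "\<dots> \<le> u (m - 1) - u (m - Suc i)" using gap_div[of i "m - Suc i"] unfolding m .
    finally have "real (N + 1 + i div p) * l \<le> a - u (m - Suc i)"
      using a[OF m(2)] by (simp add: algebra_simps)
    then have "(real (N + 1 + i div p) * l)\<^sup>2 \<le> (a - u (m - Suc i))\<^sup>2"
      using l by (intro power_mono) auto
    moreover have "0 < (real (N + 1 + i div p) * l)\<^sup>2" using l by simp
    ultimately have "1 / (a - u (m - Suc i))\<^sup>2 \<le> 1 / (real (N + 1 + i div p) * l)\<^sup>2"
      by (intro frac_le) auto
    then show "1 / (a - u (m - Suc i))\<^sup>2 \<le> g (i div p) / l\<^sup>2"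
      by (simp add: g_def power_mult_distrib)
  qed
  also have "\<dots> \<le> real p * suminf g / l\<^sup>2"
    unfolding sum_divide_distrib[symmetric] by (intro divide_right_mono sum_div_le p g) simp
  finally show ?thesis unfolding g_def .
qed

lemma near_sum_le:
  assumes b: "0 < b" "b \<le> d"
  shows "b\<^sup>2 * (\<Sum>i. 1 / (b\<^sup>2 + (real i * d)\<^sup>2)) \<le> 1 + pi\<^sup>2 / 6"
proof -
  define g where "g i = 1 / (b\<^sup>2 + (real i * d)\<^sup>2)" for i
  have g: "summable g" unfolding g_def by (rule summable_inverse_quadratic[OF d])
  have "(\<lambda>i. 1 / b\<^sup>2 * (1 / (real i + 1)\<^sup>2)) sums (1 / b\<^sup>2 * (pi\<^sup>2 / 6))"
    using inverse_squares_sums by (intro sums_mult) (simp add: add.commute)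
  moreover have "(\<lambda>i. g (Suc i)) sums (suminf g - g 0)"
    using g by (simp add: sums_Suc_iff summable_sums)
  moreover have "g (Suc i) \<le> 1 / b\<^sup>2 * (1 / (real i + 1)\<^sup>2)" for i
  proof -
    have "((real i + 1) * b)\<^sup>2 \<le> ((real i + 1) * d)\<^sup>2"
      using b by (intro power_mono mult_left_mono) auto
    then have "((real i + 1) * b)\<^sup>2 \<le> b\<^sup>2 + (real (Suc i) * d)\<^sup>2"
      using zero_le_power2[of b] by (simp only: of_nat_Suc add.commute)
    moreover have "0 < ((real i + 1) * b)\<^sup>2" using b by simp
    ultimately have "g (Suc i) \<le> 1 / ((real i + 1) * b)\<^sup>2"
      unfolding g_def by (intro frac_le) auto
    then show ?thesis by (simp add: power_mult_distrib mult.commute)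
  qed
  ultimately have "suminf g - g 0 \<le> 1 / b\<^sup>2 * (pi\<^sup>2 / 6)" by (meson sums_le)
  then have "b\<^sup>2 * suminf g \<le> b\<^sup>2 * (1 / b\<^sup>2 + 1 / b\<^sup>2 * (pi\<^sup>2 / 6))"
    by (intro mult_left_mono) (simp_all add: g_def)
  also have "\<dots> = 1 + pi\<^sup>2 / 6" using b by (simp add: distrib_left)
  finally show ?thesis unfolding g_def .
qed

end

section \<open>Blocks\<close>

text \<open>
  The \<open>p\<close> differences from \<open>t k\<close> on add up to more than \<open>d\<close>, so not all of them are below \<open>d / p\<close>.
  Hence the definite description in \<open>block_gap\<close> denotes the index of the first large one.
\<close>

lemma block_gap_props:
  assumes p: "p \<ge> 1" and gap: "\<And>k. k \<ge> 1 \<Longrightarrow> t (k + p) - t k > d" and k: "k \<ge> 1"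
  shows "t (k + block_gap t p d k + 1) - t (k + block_gap t p d k) \<ge> d / real p"
proof -
  let ?P = "\<lambda>g. g < p \<and> t (k + g + 1) - t (k + g) \<ge> d / real p \<and>
             (\<forall>j<g. t (k + j + 1) - t (k + j) < d / real p)"
  have "\<exists>g<p. t (k + g + 1) - t (k + g) \<ge> d / real p"
  proof (rule ccontr)
    assume no: "\<not> ?thesis"
    have "t (k + j) - t k \<le> real j * (d / real p)" if "j \<le> p" for j
      using that
    proof (induction j)
      case (Suc j)
      then have "t (k + j + 1) - t (k + j) < d / real p" using no by (auto simp: not_le)
      with Suc show ?case by (simp add: algebra_simps add_divide_distrib)
    qed simp
    from this[of p] show False using gap[OF k] p by simp
  qed
  then obtain g where g: "g < p \<and> t (k + g + 1) - t (k + g) \<ge> d / real p"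
    and least: "\<And>j. j < g \<Longrightarrow> \<not> (j < p \<and> t (k + j + 1) - t (k + j) \<ge> d / real p)"
    by (subst (asm) exists_least_iff) blast
  have "?P g" using g least by fastforce
  moreover have "g' = g" if "?P g'" for g'
    using that \<open>?P g\<close> by (metis linorder_neqE_nat not_le)
  ultimately have "?P (block_gap t p d k)"
    unfolding block_gap_def by (rule theI)
  then show ?thesis by blast
qed

lemma block_index_step:
  assumes p: "p \<ge> 1" and gap: "\<And>k. k \<ge> 1 \<Longrightarrow> t (k + p) - t k > d"
  shows "t (block_index t p d (k + 2) + 1) - t (block_index t p d (k + 2)) \<ge> d / real p"
    and "block_index t p d (k + 2) \<ge> k + 1"
    and "block_index t p d (k + 3) \<ge> block_index t p d (k + 2) + 1"
proof -
  note gap' = block_gap_props[where t = t and d = d, OF p gap]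
  show "t (block_index t p d (k + 2) + 1) - t (block_index t p d (k + 2)) \<ge> d / real p"
  proof (cases k)
    case 0
    then show ?thesis using gap'[of 1] by (simp add: numeral_2_eq_2)
  next
    case (Suc k')
    define s where "s = block_index t p d (Suc (Suc k')) + 1"
    have "block_index t p d (k + 2) = s + block_gap t p d s"
      unfolding s_def Suc by simp
    then show ?thesis using gap'[of s] by (simp add: s_def)
  qed
  show "block_index t p d (k + 2) \<ge> k + 1"
    by (induction k) (simp_all add: numeral_2_eq_2)
  show "block_index t p d (k + 3) \<ge> block_index t p d (k + 2) + 1"
    by (simp add: numeral_2_eq_2 numeral_3_eq_3)
qed

text \<open>Consecutive blocks are separated by a gap of length at least \<open>d / p\<close>.\<close>

lemma block_point_growth:
  assumes inc: "\<And>k. k \<ge> 1 \<Longrightarrow> t (k + 1) - t k > 0" and p: "p \<ge> 1"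
    and gap: "\<And>k. k \<ge> 1 \<Longrightarrow> t (k + p) - t k > d" and m: "m \<ge> 2"
  shows "block_point t p d (m + n) \<ge> t (m - 1) + real n * (d / real p)"
proof -
  have mono: "t i \<le> t j" if "1 \<le> i" "i \<le> j" for i j
    using that(2)
  proof (induction j rule: dec_induct)
    case (step j)
    then show ?case using inc[of j] that(1) by simp
  qed simp
  note J = block_index_step[where t = t and d = d, OF p gap]
  show ?thesis
  proof (induction n)
    case 0
    have "m - 1 \<le> block_index t p d m" using J(2)[of "m - 2"] m by (simp add: Suc_diff_Suc numeral_2_eq_2)
    then show ?case using m by (auto simp: block_point_def intro: mono)
  next
    case (Suc n)
    define k where "k = m + n - 2"
    have k: "m + n = k + 2" "m + Suc n = k + 3" using m unfolding k_def by auto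
    have "t (block_index t p d (k + 3)) \<ge> t (block_index t p d (k + 2) + 1)"
      by (rule mono[OF _ J(3)]) simp
    then show ?case
      using Suc J(1)[of k] unfolding k block_point_def by (simp add: algebra_simps add_divide_distrib)
  qed
qed

text \<open>
  From the second one on, the intervals of the blocks are adjacent, and their end points grow
  without bound.
\<close>

lemma half_strip_subset_block_rects:
  assumes inc: "\<And>k. k \<ge> 1 \<Longrightarrow> t (k + 1) - t k > 0" and p: "p \<ge> 1" and d: "d > 0"
    and gap: "\<And>k. k \<ge> 1 \<Longrightarrow> t (k + p) - t k > d" and m: "m \<ge> 2"
    and z: "block_point t p d m + d / (2 * real p) \<le> Re z" "\<bar>Im z\<bar> \<le> d / (2 * real p)"
  shows "z \<in> (\<Union>j\<in>{m..}. block_rect t p d j)"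
proof -
  define P where "P n \<longleftrightarrow> Re z \<le> block_point t p d (m + n + 1) + d / (2 * real p)" for n
  have dp: "d / real p > 0" "d / (2 * real p) > 0" using d p by auto
  obtain n where "(Re z - t (m - 1)) / (d / real p) \<le> real n" using real_arch_simple by blast
  then have "Re z \<le> t (m - 1) + real n * (d / real p)"
    using dp(1) unfolding pos_divide_le_eq[OF dp(1)] by linarith
  also have "\<dots> \<le> t (m - 1) + real (n + 1) * (d / real p)"
    using dp(1) by (intro add_left_mono mult_right_mono) auto
  also have "\<dots> \<le> block_point t p d (m + (n + 1))"
    by (rule block_point_growth[OF inc p gap m])
  finally have "P n" unfolding P_def using dp(2) by (simp add: add.assoc)
  then obtain j where j: "P j" "\<And>i. i < j \<Longrightarrow> \<not> P i"
    by (metis exists_least_iff)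
  have "block_point t p d (m + j) + d / (2 * real p) \<le> Re z"
  proof (cases j)
    case (Suc i)
    then show ?thesis using j(2)[of i] unfolding P_def by simp
  qed (use z in simp)
  then have "z \<in> block_rect t p d (m + j)"
    using j(1) z(2) m unfolding P_def block_rect_def block_interval_def by simp
  then show ?thesis by (intro UN_I[of "m + j"]) auto
qed

section \<open>Spectrum of the perturbed operator\<close>

context hilbert_basis begin

lemma diagonal_add_finite_diagonal:
  assumes A: "diagonal s D A" and I: "finite I"
  shows "diagonal (\<lambda>k. if k \<in> I then s k + c k else s k) D (\<lambda>x. A x + finite_diagonal I c x)"
proof -
  have coeff: "cinner (finite_diagonal I c x) (e k) = (if k \<in> I then c k * cinner x (e k) else 0)" for x k
    using I by (simp add: finite_diagonal_def cinner.sum_left cinner_scaleC_left orthonormal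
        if_distrib[of "\<lambda>a. _ * a"] cong: if_cong)
  have "x \<in> D \<and> A x + finite_diagonal I c x = y \<longleftrightarrow>
      (\<forall>k. cinner y (e k) = (if k \<in> I then s k + c k else s k) * cinner x (e k))" for x y
  proof -
    have "x \<in> D \<and> A x + finite_diagonal I c x = y \<longleftrightarrow> x \<in> D \<and> A x = y - finite_diagonal I c x"
      by (auto simp: eq_diff_eq)
    also have "\<dots> \<longleftrightarrow> (\<forall>k. cinner (y - finite_diagonal I c x) (e k) = s k * cinner x (e k))"
      using A unfolding diagonal_def by blast
    also have "\<dots> \<longleftrightarrow>
        (\<forall>k. cinner y (e k) = (if k \<in> I then s k + c k else s k) * cinner x (e k))"
      by (intro all_cong1) (auto simp: cinner_diff_left coeff algebra_simps)
    finally show ?thesis .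
  qed
  then show ?thesis unfolding diagonal_def by blast
qed

text \<open>
  Moving finitely many diagonal entries to one far point \<open>z + \<rho>\<close> makes any \<open>z\<close> a point of the
  resolvent set, with a resolvent of arbitrarily small norm: the terms of
  \<open>\<Sum> \<parallel>B (e k)\<parallel>\<^sup>2 / |s k - z|\<^sup>2\<close> with large index form a small tail of a convergent series, the
  others are divided by the large \<open>\<rho>\<^sup>2\<close>.
\<close>

lemma perturbed_diagonal_resolvent_far:
  assumes T: "diagonal (\<lambda>k. complex_of_real (u k)) D T"
    and B: "closed_operator E B" and DE: "D \<subseteq> E"
    and u: "filterlim u at_top sequentially"
    and v: "summable (\<lambda>k. 1 / (1 + (u k - Re z)\<^sup>2))"
    and S: "\<And>k. (norm (B (e k)))\<^sup>2 \<le> S" and r: "r > 0"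
  shows "\<exists>I c. finite I \<and> z \<in> resolvent_set D (\<lambda>x. T x + B x + finite_diagonal I c x) \<and>
    (\<forall>x\<in>D. norm x \<le> 1 / (2 * r) * norm (T x + B x + finite_diagonal I c x - z *\<^sub>C x))"
proof -
  define v where "v k = 1 / (1 + (u k - Re z)\<^sup>2)" for k
  have S0: "S \<ge> 0" using order_trans[OF zero_le_power2 S] by blast
  have "summable (\<lambda>k. 2 * S * v k)" unfolding v_def by (intro summable_mult v)
  then obtain n1 where n1: "\<And>m n. m \<ge> n1 \<Longrightarrow> norm (\<Sum>k = m..<n. 2 * S * v k) < 1 / 8"
    unfolding summable_Cauchy by (metis zero_less_divide_1_iff zero_less_numeral)
  obtain n2 where n2: "\<And>k. k \<ge> n2 \<Longrightarrow> u k \<ge> Re z + 1 + 4 * r"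
    using u unfolding filterlim_at_top eventually_sequentially by blast
  define n where "n = max n1 n2"
  \<comment> \<open>Large enough for three purposes: \<open>\<rho> \<ge> 4 r\<close>, \<open>\<rho>\<^sup>2 \<ge> \<rho>\<close> and \<open>n S / \<rho> \<le> 1 / 8\<close>.\<close>
  define \<rho> where "\<rho> = 4 * r + 1 + 8 * (real n * S)"
  define c where "c k = z + complex_of_real \<rho> - complex_of_real (u k)" for k
  define s where "s k = (if k < n then z + complex_of_real \<rho> else complex_of_real (u k))" for k
  have \<rho>: "\<rho> \<ge> 4 * r" "\<rho> \<ge> 1" "\<rho> \<ge> 8 * (real n * S)"
    using r S0 unfolding \<rho>_def by auto
  have "(\<lambda>k. if k \<in> {..<n} then complex_of_real (u k) + c k else complex_of_real (u k)) = s"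
    by (auto simp: s_def c_def)
  then have diag: "diagonal s D (\<lambda>x. T x + finite_diagonal {..<n} c x)"
    using diagonal_add_finite_diagonal[OF T, of "{..<n}" c] by simp
  have far: "cmod (complex_of_real (u k) - z) \<ge> 1 + 4 * r" if "k \<ge> n" for k
    using complex_Re_le_cmod[of "complex_of_real (u k) - z"] n2[of k] that
    unfolding n_def by simp
  have s_far: "4 * r \<le> cmod (s k - z)" for k
    using far[of k] \<rho>(1,2) unfolding s_def by (cases "k < n") auto
  have head: "(norm (B (e k)))\<^sup>2 / (cmod (s k - z))\<^sup>2 \<le> S / \<rho>\<^sup>2" if "k < n" for k
    using that S[of k] by (simp add: s_def divide_right_mono)
  have tail: "(norm (B (e k)))\<^sup>2 / (cmod (s k - z))\<^sup>2 \<le> 2 * S * v k" if "k \<ge> n" for k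
  proof -
    have "1 \<le> cmod (complex_of_real (u k) - z)" using far[OF that] r by simp
    then have "1 \<le> (cmod (complex_of_real (u k) - z))\<^sup>2" by simp
    moreover have "(cmod (complex_of_real (u k) - z))\<^sup>2 = (u k - Re z)\<^sup>2 + (Im z)\<^sup>2"
      by (simp add: cmod_power2)
    ultimately have *: "1 + (u k - Re z)\<^sup>2 \<le> 2 * (cmod (complex_of_real (u k) - z))\<^sup>2"
      by (smt (verit) zero_le_power2)
    have "(norm (B (e k)))\<^sup>2 / (cmod (s k - z))\<^sup>2 \<le> S / (cmod (complex_of_real (u k) - z))\<^sup>2"
      using S[of k] that by (simp add: s_def divide_right_mono)
    also have "\<dots> = 2 * S / (2 * (cmod (complex_of_real (u k) - z))\<^sup>2)" by simp
    also have "\<dots> \<le> 2 * S / (1 + (u k - Re z)\<^sup>2)"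
    proof (rule divide_left_mono[OF *])
      show "0 < 2 * (cmod (complex_of_real (u k) - z))\<^sup>2 * (1 + (u k - Re z)\<^sup>2)"
        using \<open>1 \<le> (cmod (complex_of_real (u k) - z))\<^sup>2\<close>
        by (intro mult_pos_pos add_pos_nonneg) auto
    qed (use S0 in simp)
    finally show ?thesis by (simp add: v_def)
  qed
  have sum_le: "(\<Sum>k<m. (norm (B (e k)))\<^sup>2 / (cmod (s k - z))\<^sup>2) \<le> 1 / 4" for m
  proof -
    have "(\<Sum>k<m. (norm (B (e k)))\<^sup>2 / (cmod (s k - z))\<^sup>2)
        \<le> (\<Sum>k<n + m. (norm (B (e k)))\<^sup>2 / (cmod (s k - z))\<^sup>2)"
      by (intro sum_mono2) auto
    also have "\<dots> \<le> (\<Sum>k<n. S / \<rho>\<^sup>2) + (\<Sum>k<m. 2 * S * v (n + k))"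
      unfolding sum_lessThan_add by (intro add_mono sum_mono head tail) auto
    also have "(\<Sum>k<n. S / \<rho>\<^sup>2) \<le> 1 / 8"
    proof -
      have "8 * (real n * S) \<le> \<rho> * \<rho>"
        using \<rho>(2,3) mult_left_mono[of 1 \<rho> \<rho>] by linarith
      then show ?thesis using \<rho>(2) by (simp add: power2_eq_square field_simps)
    qed
    also have "(\<Sum>k<m. 2 * S * v (n + k)) = (\<Sum>k = n..<n + m. 2 * S * v k)"
      using sum.shift_bounds_nat_ivl[of "\<lambda>k. 2 * S * v k" 0 n m]
      by (simp add: atLeast0LessThan add.commute)
    also have "\<dots> \<le> 1 / 8"
      using n1[of n "n + m"] unfolding n_def by simp
    finally show ?thesis by simp
  qed
  have r4: "4 * r > 0" using r by simp
  note inv = perturbed_diagonal_invertible[OF diag B DE r4 s_far sum_le]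
  have comm: "T x + finite_diagonal {..<n} c x + B x = T x + B x + finite_diagonal {..<n} c x" for x by simp
  have sqrt4: "sqrt (1 / 4) = 1 / (2 :: real)" by (simp add: real_sqrt_divide)
  have "z \<in> resolvent_set D (\<lambda>x. T x + B x + finite_diagonal {..<n} c x)"
    using inv(1) unfolding comm by simp
  moreover have "norm x \<le> 1 / (2 * r) * norm (T x + B x + finite_diagonal {..<n} c x - z *\<^sub>C x)" if "x \<in> D" for x
    using inv(2)[OF _ that] r unfolding comm sqrt4 by simp
  ultimately show ?thesis by (intro exI[of _ "{..<n}"] exI[of _ c]) simp
qed

end

theorem proposition1:
  fixes domT domB :: "'a::complex_hilbert set"
    and T B :: "'a \<Rightarrow> 'a"
    and t :: "nat \<Rightarrow> real"
    and \<phi> :: "nat \<Rightarrow> 'a"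
    and p M N K :: nat
    and d h :: real
  assumes separable: "\<exists>S :: 'a set. countable S \<and> closure S = UNIV"
    and T_selfadjoint: "selfadjoint_operator domT T"
    and T_discrete: "discrete_spectrum domT T"
    and T_spectrum: "spectrum domT T = {complex_of_real (t k) |k. k \<ge> 1}"
    and basis: "orthonormal_basis_on {1..} \<phi>"
    and eigen: "\<And>k. k \<ge> 1 \<Longrightarrow> \<phi> k \<in> domT \<and> T (\<phi> k) = complex_of_real (t k) *\<^sub>C \<phi> k"
    and t_nonneg: "0 \<le> t 1"
    and t_increasing: "\<And>k. k \<ge> 1 \<Longrightarrow> t (k + 1) - t k > 0"
    and p_pos: "p \<ge> 1"
    and d_pos: "d > 0"
    and t_gap: "\<And>k. k \<ge> 1 \<Longrightarrow> t (k + p) - t k > d"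
    and B_closed: "closed_operator domB B"
    and dom_incl: "domT \<subseteq> domB"
    and limsup_small:
      "limsup (\<lambda>k. ereal (pert_seq B \<phi> k))
         < ereal ((d / (2 * real p))\<^sup>2 * (1 / (8 * real p * (1 + pi\<^sup>2 / 3))))"
    and M_pos: "M \<ge> 1"
    and M_bound:
      "\<And>k. k \<ge> M \<Longrightarrow>
         pert_seq B \<phi> k \<le> (d / (2 * real p))\<^sup>2 * (1 / (8 * real p * (1 + pi\<^sup>2 / 3)))"
    and N_bound:
      "pert_sup B \<phi>
         \<le> d\<^sup>2 / (16 * (real p)\<^sup>2) * inverse (2 * real p * (\<Sum>j. 1 / (real (N + 1 + j))\<^sup>2))"
    and K_eq: "K = M + N"
    and h_pos: "h > 0"
    and h_bound:
      "pert_sup B \<phi> = 0 \<or>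
         (\<Sum>j. 1 / (h\<^sup>2 + (real j * d / (2 * real p))\<^sup>2)) \<le> 1 / (8 * real p * pert_sup B \<phi>)"
  shows "discrete_spectrum domT (\<lambda>x. T x + B x) \<and>
         spectrum domT (\<lambda>x. T x + B x)
           \<subseteq> initial_rect t p d K h \<union> (\<Union>j\<in>{K + 1..}. block_rect t p d j)"
proof -
  \<comment> \<open>Indices are counted from 0 from here on, so \<open>k \<ge> M\<close> becomes \<open>k \<ge> M - 1\<close>.\<close>
  define e where "e = (\<lambda>k. \<phi> (Suc k))"
  define u where "u = (\<lambda>k. t (Suc k))"
  define \<delta> where "\<delta> = d / (2 * real p)"
  define S where "S = pert_sup B \<phi>"
  define L where "L = (\<lambda>x. T x + B x)"
  define w where "w k = (norm (B (e k)))\<^sup>2" for k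
  have p0: "real p > 0" using p_pos by simp
  have \<delta>: "0 < \<delta>" "2 * \<delta> \<le> d" "d / real p = 2 * \<delta>"
    using d_pos p_pos by (auto simp: \<delta>_def field_simps)
  have range_e: "range e = \<phi> ` {1..}"
  proof -
    have "{1..} = range Suc" by (auto simp: image_iff Suc_le_eq gr0_conv_Suc)
    then show ?thesis unfolding e_def by (simp add: image_image)
  qed
  interpret hilbert_basis e
    by unfold_locales
      (use basis in \<open>auto simp: orthonormal_basis_on_def e_def range_e[unfolded e_def]\<close>)
  interpret gapped_sequence u p d
  proof
    show "d < u (k + p) - u k" for k using t_gap[of "Suc k"] by (simp add: u_def)
  qed (use t_increasing p_pos d_pos in \<open>auto simp: u_def\<close>)
  have T: "diagonal (\<lambda>k. complex_of_real (u k)) domT T"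
    by (rule selfadjoint_diagonal[OF T_selfadjoint]) (use eigen in \<open>auto simp: e_def u_def\<close>)
  have B_lin: "linear_operator domB B" using B_closed by (simp add: closed_operator_def)
  have L_lin: "linear_operator domT L"
    unfolding L_def by (rule linear_operator_add[OF diagonal_linear_operator[OF T] B_lin dom_incl])

  have bdd: "bdd_above (pert_seq B \<phi> ` {1..})"
  proof (rule bdd_above_mono)
    show "bdd_above (pert_seq B \<phi> ` {..<M} \<union>
        {..(d / (2 * real p))\<^sup>2 * (1 / (8 * real p * (1 + pi\<^sup>2 / 3)))})" by simp
    show "pert_seq B \<phi> ` {1..} \<subseteq> pert_seq B \<phi> ` {..<M} \<union>
        {..(d / (2 * real p))\<^sup>2 * (1 / (8 * real p * (1 + pi\<^sup>2 / 3)))}"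
    proof
      fix y assume "y \<in> pert_seq B \<phi> ` {1..}"
      then obtain k where "y = pert_seq B \<phi> k" by blast
      then show "y \<in> pert_seq B \<phi> ` {..<M} \<union>
          {..(d / (2 * real p))\<^sup>2 * (1 / (8 * real p * (1 + pi\<^sup>2 / 3)))}"
        using M_bound[of k] by (cases "k < M") auto
    qed
  qed
  have w_S: "w k \<le> S" for k
    unfolding S_def pert_sup_def w_def e_def pert_seq_def[symmetric]
    by (rule cSUP_upper[OF _ bdd]) simp
  have w0: "0 \<le> w k" for k by (simp add: w_def)
  have S0: "0 \<le> S" using order_trans[OF w0 w_S] .

  \<comment> \<open>\<open>h_bound\<close> is a series over multiples of \<open>\<delta>\<close>; the points \<open>u k\<close> leave only multiples of \<open>d \<ge> \<delta>\<close>.\<close>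
  define W where "W = (\<Sum>i. 1 / (h\<^sup>2 + (real i * d)\<^sup>2))"
  have SW: "S * (2 * real p * W) \<le> 1 / 4"
  proof (cases "S = 0")
    case False
    have "W \<le> (\<Sum>i. 1 / (h\<^sup>2 + (real i * \<delta>)\<^sup>2))"
      unfolding W_def
    proof (intro suminf_le summable_inverse_quadratic \<delta> d_pos)
      fix i
      have "(real i * \<delta>)\<^sup>2 \<le> (real i * d)\<^sup>2"
        using \<delta> by (intro power_mono mult_left_mono) auto
      moreover have "0 < h\<^sup>2 + (real i * \<delta>)\<^sup>2" using h_pos by (simp add: add_pos_nonneg)
      ultimately show "1 / (h\<^sup>2 + (real i * d)\<^sup>2) \<le> 1 / (h\<^sup>2 + (real i * \<delta>)\<^sup>2)"
        by (intro frac_le) auto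
    qed
    also have "\<dots> \<le> 1 / (8 * real p * S)"
      using h_bound False by (simp add: S_def \<delta>_def)
    finally show ?thesis using False S0 p0 by (simp add: field_simps)
  qed simp

  have resolvent: "z \<in> resolvent_set domT L"
    if "c > 0" "\<And>k. c \<le> cmod (complex_of_real (u k) - z)"
      and "\<And>n. (\<Sum>k<n. w k / (cmod (complex_of_real (u k) - z))\<^sup>2) \<le> 1 / 2" for c z
    using perturbed_diagonal_invertible(1)[OF T B_closed dom_incl that(1,2), of "1 / 2"] that(3)
    unfolding L_def w_def by simp
  have dist_sq: "(cmod (complex_of_real (u k) - z))\<^sup>2 = (Im z)\<^sup>2 + (u k - Re z)\<^sup>2" for k z
    by (simp add: cmod_power2)

  have above: "z \<in> resolvent_set domT L" if "h \<le> \<bar>Im z\<bar>" for z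
  proof (rule resolvent[OF h_pos])
    show "h \<le> cmod (complex_of_real (u k) - z)" for k
      using abs_Im_le_cmod[of "complex_of_real (u k) - z"] that by simp
    have "h\<^sup>2 + (u k - Re z)\<^sup>2 \<le> (cmod (complex_of_real (u k) - z))\<^sup>2" for k
      unfolding dist_sq using power_mono[OF that, of 2] h_pos by simp
    then have "(\<Sum>k<n. w k / (cmod (complex_of_real (u k) - z))\<^sup>2) \<le> S * (2 * real p * W)" for n
      unfolding W_def using h_pos by (intro weighted_sum_le w0 w_S) auto
    then show "(\<Sum>k<n. w k / (cmod (complex_of_real (u k) - z))\<^sup>2) \<le> 1 / 2" for n
      by (rule order_trans) (use SW in simp)
  qed

  have left: "z \<in> resolvent_set domT L" if "Re z \<le> - h" for z
  proof (rule resolvent[OF h_pos])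
    have far: "h + real (k div p) * d \<le> u k - Re z" for k
      using gap_div[of k 0] t_nonneg that by (simp add: u_def)
    show "h \<le> cmod (complex_of_real (u k) - z)" for k
    proof -
      have "0 \<le> real (k div p) * d" using d_pos by simp
      moreover have "u k - Re z \<le> cmod (complex_of_real (u k) - z)"
        using complex_Re_le_cmod[of "complex_of_real (u k) - z"] by simp
      ultimately show ?thesis using far[of k] by linarith
    qed
    define g where "g i = 1 / (h\<^sup>2 + (real i * d)\<^sup>2)" for i
    have g: "summable g" "\<And>i. 0 \<le> g i"
      unfolding g_def by (rule summable_inverse_quadratic[OF d_pos]) simp
    have "w k / (cmod (complex_of_real (u k) - z))\<^sup>2 \<le> S * g (k div p)" for k
    proof -
      have "h\<^sup>2 + (real (k div p) * d)\<^sup>2 \<le> (h + real (k div p) * d)\<^sup>2"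
        using h_pos d_pos by (simp add: power2_sum)
      also have "\<dots> \<le> (u k - Re z)\<^sup>2"
        using far[of k] h_pos d_pos by (intro power_mono) auto
      also have "\<dots> \<le> (cmod (complex_of_real (u k) - z))\<^sup>2" unfolding dist_sq by simp
      finally have "h\<^sup>2 + (real (k div p) * d)\<^sup>2 \<le> (cmod (complex_of_real (u k) - z))\<^sup>2" .
      moreover have "0 < h\<^sup>2 + (real (k div p) * d)\<^sup>2" using h_pos by (simp add: add_pos_nonneg)
      ultimately show ?thesis
        using frac_le[OF S0 w_S[of k]] by (simp add: g_def)
    qed
    then have "(\<Sum>k<n. w k / (cmod (complex_of_real (u k) - z))\<^sup>2) \<le> S * (\<Sum>k<n. g (k div p))" for n
      unfolding sum_distrib_left by (rule sum_mono)
    also have "S * (\<Sum>k<n. g (k div p)) \<le> S * (real p * W)" for n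
      unfolding W_def g_def[symmetric] by (intro mult_left_mono sum_div_le p_pos g S0)
    also have "S * (real p * W) \<le> 1 / 2" using SW by simp
    finally show "(\<Sum>k<n. w k / (cmod (complex_of_real (u k) - z))\<^sup>2) \<le> 1 / 2" for n .
  qed

  have right: "z \<in> resolvent_set domT L"
    if z: "block_point t p d (K + 1) + \<delta> \<le> Re z" "\<delta> \<le> \<bar>Im z\<bar>" for z
  proof (rule resolvent[OF \<delta>(1)])
    show "\<delta> \<le> cmod (complex_of_real (u k) - z)" for k
      using abs_Im_le_cmod[of "complex_of_real (u k) - z"] z(2) by simp
    fix n
    define D where "D k = (cmod (complex_of_real (u k) - z))\<^sup>2" for k
    define c where "c = \<delta>\<^sup>2 * (1 / (8 * real p * (1 + pi\<^sup>2 / 3)))"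
    define Z where "Z = (\<Sum>j. 1 / (real (N + 1 + j))\<^sup>2)"
    have D0: "0 \<le> D k" for k unfolding D_def by simp
    have pi0: "0 < 1 + pi\<^sup>2 / 3" by (simp add: add_pos_nonneg)
    have c0: "0 \<le> c" unfolding c_def using p0 pi0 by simp
    have "summable (\<lambda>j. inverse (real (j + (N + 1)) ^ 2))"
      by (intro summable_ignore_initial_segment inverse_power_summable) simp
    then have "summable (\<lambda>j. 1 / (real (N + 1 + j))\<^sup>2)"
      by (simp add: inverse_eq_divide add_ac)
    then have Z0: "0 < Z" unfolding Z_def by (rule suminf_pos) simp

    \<comment> \<open>The indices from \<open>M\<close> on, with the points on both sides of \<open>z\<close>.\<close>
    have near: "(\<Sum>k<n. c / D k) \<le> 1 / 4"
    proof -
      have "\<delta>\<^sup>2 + (u k - Re z)\<^sup>2 \<le> D k" for k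
        unfolding D_def dist_sq using power_mono[OF z(2), of 2] \<delta>(1) by simp
      then have "(\<Sum>k<n. c / D k) \<le> c * (2 * real p * (\<Sum>i. 1 / (\<delta>\<^sup>2 + (real i * d)\<^sup>2)))"
        using \<delta>(1) c0 by (intro weighted_sum_le) auto
      also have "\<dots> = (\<delta>\<^sup>2 * (\<Sum>i. 1 / (\<delta>\<^sup>2 + (real i * d)\<^sup>2))) / (4 * (1 + pi\<^sup>2 / 3))"
      proof -
        have "\<delta>\<^sup>2 * (1 / (8 * real p * b)) * (2 * real p * a) = \<delta>\<^sup>2 * a / (4 * b)" for a b
          using p0 by simp
        then show ?thesis unfolding c_def .
      qed
      also have "\<dots> \<le> (1 + pi\<^sup>2 / 3) / (4 * (1 + pi\<^sup>2 / 3))"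
      proof (rule divide_right_mono)
        show "\<delta>\<^sup>2 * (\<Sum>i. 1 / (\<delta>\<^sup>2 + (real i * d)\<^sup>2)) \<le> 1 + pi\<^sup>2 / 3"
          using near_sum_le[of \<delta>] \<delta> zero_le_power2[of pi] by linarith
      qed (use pi0 in simp)
      also have "\<dots> = 1 / 4" using pi0 by simp
      finally show ?thesis .
    qed

    \<comment> \<open>The indices below \<open>M\<close>, separated from \<open>z\<close> by at least \<open>N + 1\<close> gaps between blocks.\<close>
    have far: "(\<Sum>k<M - 1. S / D k) \<le> 1 / 4"
    proof -
      have sep: "u (M - 1 - 1) + real (N + 1) * (2 * \<delta>) \<le> Re z" if "M - 1 \<ge> 1"
      proof -
        have "t (M - 1) + real (N + 1) * (2 * \<delta>) \<le> block_point t p d (K + 1)"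
          using block_point_growth[OF t_increasing p_pos t_gap, of M "N + 1"] that
          unfolding K_eq \<delta>(3) by (simp add: add.assoc)
        moreover have "Suc (M - 1 - 1) = M - 1" using that by arith
        then have "u (M - 1 - 1) = t (M - 1)" by (simp only: u_def)
        ultimately show ?thesis using z(1) \<delta>(1) by linarith
      qed
      have pos: "0 < Re z - u k" if "k < M - 1" for k
      proof -
        have "u k \<le> u (M - 1 - 1)" using that by (intro u_mono) simp
        moreover have "0 < real (N + 1) * (2 * \<delta>)" using \<delta>(1) by simp
        ultimately show ?thesis using sep that by linarith
      qed
      have "(\<Sum>k<M - 1. S / D k) \<le> (\<Sum>k<M - 1. S * (1 / (Re z - u k)\<^sup>2))"
      proof (rule sum_mono)
        fix k assume "k \<in> {..<M - 1}"
        then have "0 < (Re z - u k)\<^sup>2" using pos[of k] by simp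
        moreover have "(Re z - u k)\<^sup>2 \<le> D k"
          unfolding D_def dist_sq by (simp add: power2_commute)
        ultimately show "S / D k \<le> S * (1 / (Re z - u k)\<^sup>2)"
          using frac_le[OF S0 order_refl] by simp
      qed
      also have "\<dots> \<le> S * (real p * Z / (2 * \<delta>)\<^sup>2)"
        unfolding sum_distrib_left[symmetric] Z_def
        by (intro mult_left_mono far_sum_le sep S0) (use \<delta> in auto)
      also have "\<dots> \<le> (\<delta>\<^sup>2 / 4 * inverse (2 * real p * Z)) * (real p * Z / (2 * \<delta>)\<^sup>2)"
      proof (rule mult_right_mono)
        have "d\<^sup>2 / (16 * (real p)\<^sup>2) = \<delta>\<^sup>2 / 4"
          by (simp add: \<delta>_def power_divide power_mult_distrib)
        then show "S \<le> \<delta>\<^sup>2 / 4 * inverse (2 * real p * Z)"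
          using N_bound unfolding S_def Z_def by (simp only:)
      qed (use p0 Z0 in simp)
      also have "\<dots> = 1 / 32"
        using p0 Z0 \<delta>(1) by (simp add: field_simps power2_eq_square)
      finally show ?thesis by simp
    qed

    have split: "w k / D k \<le> c / D k + (if k < M - 1 then S / D k else 0)" for k
    proof (cases "k < M - 1")
      case True
      then show ?thesis
        using divide_right_mono[OF w_S D0, of k k] divide_nonneg_nonneg[OF c0 D0, of k] by simp
    next
      case False
      then have "w k \<le> c"
        using M_bound[of "Suc k"] unfolding w_def e_def pert_seq_def c_def \<delta>_def by simp
      then show ?thesis using False divide_right_mono[OF _ D0] by simp
    qed
    have "(\<Sum>k<n. w k / D k) \<le> (\<Sum>k<n. c / D k) + (\<Sum>k<n. if k < M - 1 then S / D k else 0)"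
      unfolding sum.distrib[symmetric] by (rule sum_mono) (rule split)
    also have "(\<Sum>k<n. if k < M - 1 then S / D k else 0)
        \<le> (\<Sum>k<M - 1 + n. if k < M - 1 then S / D k else 0)"
      using S0 D0 by (intro sum_mono2) auto
    also have "\<dots> = (\<Sum>k<M - 1. S / D k)" unfolding sum_lessThan_add by simp
    finally show "(\<Sum>k<n. w k / (cmod (complex_of_real (u k) - z))\<^sup>2) \<le> 1 / 2"
      using near far unfolding D_def by simp
  qed

  have "spectrum domT L \<subseteq> initial_rect t p d K h \<union> (\<Union>j\<in>{K + 1..}. block_rect t p d j)"
  proof
    fix z assume "z \<in> spectrum domT L"
    then have z: "z \<notin> resolvent_set domT L" by (simp add: spectrum_def)
    have "- h \<le> Re z" "\<bar>Im z\<bar> \<le> h" using left above z by (meson linear)+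
    moreover have "z \<in> (\<Union>j\<in>{K + 1..}. block_rect t p d j)"
      if "block_point t p d (K + 1) + \<delta> \<le> Re z"
    proof (rule half_strip_subset_block_rects[OF t_increasing p_pos d_pos t_gap])
      show "2 \<le> K + 1" using M_pos K_eq by simp
      show "\<bar>Im z\<bar> \<le> d / (2 * real p)" using right that z unfolding \<delta>_def by (meson linear)
      show "block_point t p d (K + 1) + d / (2 * real p) \<le> Re z"
        using that unfolding \<delta>_def .
    qed
    ultimately show "z \<in> initial_rect t p d K h \<union> (\<Union>j\<in>{K + 1..}. block_rect t p d j)"
      unfolding initial_rect_def \<delta>_def by (auto simp: not_le) (meson linear)
  qed
  moreover have "discrete_spectrum domT L"
  proof (rule discrete_spectrumI[OF L_lin])
    show "Complex 0 h \<in> resolvent_set domT L" by (rule above) simp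
    show "\<exists>I c. finite I \<and> z \<in> resolvent_set domT (\<lambda>x. L x + finite_diagonal I c x) \<and>
        (\<forall>x\<in>domT. norm x \<le> 1 / (2 * r) * norm (L x + finite_diagonal I c x - z *\<^sub>C x))"
      if "r > 0" for z and r :: real
      unfolding L_def
    proof (rule perturbed_diagonal_resolvent_far[OF T B_closed dom_incl u_at_top _ w_S[unfolded w_def] that])
      show "summable (\<lambda>k. 1 / (1 + (u k - Re z)\<^sup>2))"
        using sum_inverse_quadratic_le[of 1 "Re z"]
        by (intro summableI_nonneg_bounded) auto
    qed
  qed
  ultimately show ?thesis unfolding L_def by blast
qed

end
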